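(* Let $\mathbb X$ be a Banach space over $\mathbb K$ and let $\{\mathbf e_n,\mathbf e_n^*\}_{n=1}^\infty$ be a semi-normalized biorthogonal system in $\mathbb X\times\mathbb X^*$ whose vectors $\mathbf e_n$ have dense span (as in the context). Assume that $\mathscr B=\{\mathbf e_n\}$ is quasi-greedy, and let $\mathbf q=\min\{\sup_{G\in\mathscr G}\|G\|,\ \sup_{G\in\mathscr G}\|I-G\|\}$. If $\mathbb K=\mathbb R$, then for all $N\ge1$ $$\max\{k_N^c,\mu_N\}\le\mathbf L_N\le k_{2N}^c+8\,\mathbf q^2\,\mu_N$$ and $$\max\{g_N^c,\mu_N\}\le\widetilde{\mathbf L}_N\le g_N^c+8\,\mathbf q^2\,\mu_N .$$ If $\mathbb K=\mathbb C$, the same holds with the last summand multiplied by $4$, i.e. with $32\,\mathbf q^2\mu_N$ in place of $8\,\mathbf q^2\mu_N$.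
   Context: Setting: $\mathbb X$ is a Banach space over $\mathbb K=\mathbb R$ or $\mathbb C$; $\{\mathbf e_n,\mathbf e_n^*\}_{n=1}^\infty\subset\mathbb X\times\mathbb X^*$ satisfies $\mathbf e_m^*(\mathbf e_n)=\delta_{m,n}$; $\mathscr B=\{\mathbf e_n\}$ has dense linear span in $\mathbb X$; and $0<\kappa_1\le\|\mathbf e_n\|,\|\mathbf e_n^*\|\le\kappa_2<\infty$ for all $n$. (Then $\lim_n\mathbf e_n^*(x)=0$ for all $x\in\mathbb X$.) Projections: for finite $A\subset\mathbb N$, $P_Ax=\sum_{n\in A}\mathbf e_n^*(x)\mathbf e_n$. Greedy sets: a finite set $\Gamma\subset\mathbb N$ is a greedy set for $x$ if $\min_{n\in\Gamma}|\mathbf e_n^*(x)|\ge\max_{n\in\Gamma^c}|\mathbf e_n^*(x)|$; $\mathscr G(x,N)$ is the collection of greedy sets for $x$ of cardinality $N$. $\mathscr G_N$ is the set of all maps $G:\mathbb X\to\mathbb X$ with $Gx=P_{\Gamma_x}x$ for some choice $\Gamma_x\in\mathscr G(x,N)$, for each $x$; $\mathscr G=\bigcup_{N\ge1}\mathscr G_N$. For a (possibly non-linear) map $G$, $\|G\|=\sup_{x\ne0}\|Gx\|/\|x\|$. The basis $\mathscr B$ is quasi-greedy if $\sup_{G\in\mathscr G}\|G\|<\infty$ (equivalently $\mathbf q<\infty$). Approximation errors: $\Sigma_N=\{\sum_{n\in A}a_n\mathbf e_n: |A|\le N,\ a_n\in\mathbb K\}$, $\sigma_N(x)=\operatorname{dist}(x,\Sigma_N)$,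 $\widetilde\sigma_N(x)=\inf\{\|x-P_Ax\|: |A|\le N\}$. Lebesgue constants: $\mathbf L_N$ (resp. $\widetilde{\mathbf L}_N$) is the smallest number such that $\|x-Gx\|\le\mathbf L_N\sigma_N(x)$ (resp. $\|x-Gx\|\le\widetilde{\mathbf L}_N\widetilde\sigma_N(x)$) for all $x\in\mathbb X$ and all $G\in\mathscr G_N$. Other constants: $k_N^c=\sup_{|A|\le N}\|I-P_A\|$; $g_N^c=\sup\{\|I-G\|: G\in\bigcup_{1\le k\le N}\mathscr G_k\}$; $\mu_N=\sup_{|A|=|B|\le N}\|\mathbf 1_A\|/\|\mathbf 1_B\|$ (nonempty finite sets), where $\mathbf 1_A=\sum_{n\in A}\mathbf e_n$. *)

theory Defs
  imports "HOL-Analysis.Analysis" "HOL-Library.Extended_Nonnegative_Real"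
begin

text \<open>
  The class \<open>banach\<close> provides only real scalars. A Banach space over a scalar field \<open>'k\<close>
  (here always \<open>real\<close> or \<open>complex\<close>) is a type of class \<open>banach\<close> together with a scalar
  multiplication \<open>smul\<close> by \<open>'k\<close> that extends the real one and for which the norm is
  homogeneous. For \<open>'k = real\<close> this forces \<open>smul = scaleR\<close>.
\<close>

definition banach_over :: "('k::real_normed_field \<Rightarrow> 'a::banach \<Rightarrow> 'a) \<Rightarrow> bool" where
  "banach_over smul \<longleftrightarrow>
     vector_space smul \<and>
     (\<forall>r x. smul (of_real r) x = r *\<^sub>R x) \<and>
     (\<forall>c x. norm (smul c x) = norm c * norm x)"

text \<open>
  The system is indexed by \<open>nat\<close>, so it starts at \<open>0\<close> rather than at \<open>1\<close>.
  For \<open>'k\<close>-linear functionals, \<open>onorm\<close> is the dual norm.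
\<close>

definition seminormalized_biorthogonal_system ::
    "('k::real_normed_field \<Rightarrow> 'a::banach \<Rightarrow> 'a) \<Rightarrow> (nat \<Rightarrow> 'a) \<Rightarrow> (nat \<Rightarrow> 'a \<Rightarrow> 'k) \<Rightarrow> bool" where
  "seminormalized_biorthogonal_system smul e es \<longleftrightarrow>
     banach_over smul \<and>
     (\<forall>n. Vector_Spaces.linear smul (*) (es n) \<and> bounded_linear (es n)) \<and>
     (\<forall>m n. es m (e n) = (if m = n then 1 else 0)) \<and>
     closure (module.span smul (range e)) = UNIV \<and>
     (\<exists>\<kappa>1 \<kappa>2. 0 < \<kappa>1 \<and>
        (\<forall>n. \<kappa>1 \<le> norm (e n) \<and> norm (e n) \<le> \<kappa>2 \<and> \<kappa>1 \<le> onorm (es n) \<and> onorm (es n) \<le> \<kappa>2))"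

definition coord_proj ::
    "('k \<Rightarrow> 'a \<Rightarrow> 'a) \<Rightarrow> (nat \<Rightarrow> 'a) \<Rightarrow> (nat \<Rightarrow> 'a \<Rightarrow> 'k) \<Rightarrow> nat set \<Rightarrow> 'a::real_normed_vector \<Rightarrow> 'a" where
  "coord_proj smul e es A x = (\<Sum>n\<in>A. smul (es n x) (e n))"

text \<open>The comparison of the minimum over \<open>\<Gamma>\<close> with the maximum over its (infinite)
  complement is written out elementwise.\<close>

definition greedy_sets ::
    "(nat \<Rightarrow> 'a \<Rightarrow> 'k::real_normed_field) \<Rightarrow> 'a \<Rightarrow> nat \<Rightarrow> nat set set" where
  "greedy_sets es x N =
     {\<Gamma>. finite \<Gamma> \<and> card \<Gamma> = N \<and> (\<forall>n\<in>\<Gamma>. \<forall>m\<in>-\<Gamma>. norm (es n x) \<ge> norm (es m x))}"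

definition greedy_ops ::
    "('k::real_normed_field \<Rightarrow> 'a::real_normed_vector \<Rightarrow> 'a) \<Rightarrow> (nat \<Rightarrow> 'a) \<Rightarrow> (nat \<Rightarrow> 'a \<Rightarrow> 'k)
       \<Rightarrow> nat \<Rightarrow> ('a \<Rightarrow> 'a) set" where
  "greedy_ops smul e es N =
     {G. \<exists>\<Gamma>. (\<forall>x. \<Gamma> x \<in> greedy_sets es x N) \<and> (\<forall>x. G x = coord_proj smul e es (\<Gamma> x) x)}"

definition all_greedy_ops ::
    "('k::real_normed_field \<Rightarrow> 'a::real_normed_vector \<Rightarrow> 'a) \<Rightarrow> (nat \<Rightarrow> 'a) \<Rightarrow> (nat \<Rightarrow> 'a \<Rightarrow> 'k)
       \<Rightarrow> ('a \<Rightarrow> 'a) set" where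
  "all_greedy_ops smul e es = (\<Union>N\<in>{1..}. greedy_ops smul e es N)"

text \<open>
  All suprema and constants below are extended nonnegative reals, so that an
  unbounded supremum is \<open>\<infinity>\<close> and not an unspecified real number. In contrast
  to \<open>onorm\<close>, the following is meaningful for nonlinear and for unbounded maps.
\<close>

definition map_norm :: "('a::real_normed_vector \<Rightarrow> 'a) \<Rightarrow> ennreal" where
  "map_norm G = (SUP x\<in>{x. x \<noteq> 0}. ennreal (norm (G x) / norm x))"

definition quasi_greedy ::
    "('k::real_normed_field \<Rightarrow> 'a::real_normed_vector \<Rightarrow> 'a) \<Rightarrow> (nat \<Rightarrow> 'a) \<Rightarrow> (nat \<Rightarrow> 'a \<Rightarrow> 'k)
       \<Rightarrow> bool" where
  "quasi_greedy smul e es \<longleftrightarrow> (SUP G\<in>all_greedy_ops smul e es. map_norm G) < \<infinity>"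

definition qg_const ::
    "('k::real_normed_field \<Rightarrow> 'a::real_normed_vector \<Rightarrow> 'a) \<Rightarrow> (nat \<Rightarrow> 'a) \<Rightarrow> (nat \<Rightarrow> 'a \<Rightarrow> 'k)
       \<Rightarrow> ennreal" where
  "qg_const smul e es =
     min (SUP G\<in>all_greedy_ops smul e es. map_norm G)
         (SUP G\<in>all_greedy_ops smul e es. map_norm (\<lambda>x. x - G x))"

definition Sigma_set ::
    "('k \<Rightarrow> 'a::real_normed_vector \<Rightarrow> 'a) \<Rightarrow> (nat \<Rightarrow> 'a) \<Rightarrow> nat \<Rightarrow> 'a set" where
  "Sigma_set smul e N = {\<Sum>n\<in>A. smul (a n) (e n) | A a. finite A \<and> card A \<le> N}"

definition sigma_err ::
    "('k \<Rightarrow> 'a::real_normed_vector \<Rightarrow> 'a) \<Rightarrow> (nat \<Rightarrow> 'a) \<Rightarrow> nat \<Rightarrow> 'a \<Rightarrow> real" where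
  "sigma_err smul e N x = infdist x (Sigma_set smul e N)"

definition sigma_tilde_err ::
    "('k \<Rightarrow> 'a::real_normed_vector \<Rightarrow> 'a) \<Rightarrow> (nat \<Rightarrow> 'a) \<Rightarrow> (nat \<Rightarrow> 'a \<Rightarrow> 'k) \<Rightarrow> nat \<Rightarrow> 'a \<Rightarrow> real" where
  "sigma_tilde_err smul e es N x =
     (INF A\<in>{A. finite A \<and> card A \<le> N}. norm (x - coord_proj smul e es A x))"

text \<open>
  The smallest admissible constant, as an infimum in \<open>ennreal\<close> (equal to \<open>\<infinity>\<close> if no
  finite constant is admissible; when finite, the infimum is itself admissible).
\<close>

definition lebesgue_const ::
    "('k::real_normed_field \<Rightarrow> 'a::real_normed_vector \<Rightarrow> 'a) \<Rightarrow> (nat \<Rightarrow> 'a) \<Rightarrow> (nat \<Rightarrow> 'a \<Rightarrow> 'k)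
       \<Rightarrow> nat \<Rightarrow> ennreal" where
  "lebesgue_const smul e es N =
     Inf {C. \<forall>x. \<forall>G\<in>greedy_ops smul e es N.
               ennreal (norm (x - G x)) \<le> C * ennreal (sigma_err smul e N x)}"

definition lebesgue_tilde_const ::
    "('k::real_normed_field \<Rightarrow> 'a::real_normed_vector \<Rightarrow> 'a) \<Rightarrow> (nat \<Rightarrow> 'a) \<Rightarrow> (nat \<Rightarrow> 'a \<Rightarrow> 'k)
       \<Rightarrow> nat \<Rightarrow> ennreal" where
  "lebesgue_tilde_const smul e es N =
     Inf {C. \<forall>x. \<forall>G\<in>greedy_ops smul e es N.
               ennreal (norm (x - G x)) \<le> C * ennreal (sigma_tilde_err smul e es N x)}"

definition kc_const ::
    "('k \<Rightarrow> 'a::real_normed_vector \<Rightarrow> 'a) \<Rightarrow> (nat \<Rightarrow> 'a) \<Rightarrow> (nat \<Rightarrow> 'a \<Rightarrow> 'k) \<Rightarrow> nat \<Rightarrow> ennreal" where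
  "kc_const smul e es N =
     (SUP A\<in>{A. finite A \<and> card A \<le> N}. map_norm (\<lambda>x. x - coord_proj smul e es A x))"

definition gc_const ::
    "('k::real_normed_field \<Rightarrow> 'a::real_normed_vector \<Rightarrow> 'a) \<Rightarrow> (nat \<Rightarrow> 'a) \<Rightarrow> (nat \<Rightarrow> 'a \<Rightarrow> 'k)
       \<Rightarrow> nat \<Rightarrow> ennreal" where
  "gc_const smul e es N =
     (SUP G\<in>(\<Union>k\<in>{1..N}. greedy_ops smul e es k). map_norm (\<lambda>x. x - G x))"

definition mu_const :: "(nat \<Rightarrow> 'a::real_normed_vector) \<Rightarrow> nat \<Rightarrow> ennreal" where
  "mu_const e N =
     (SUP (A, B)\<in>{(A, B). finite A \<and> finite B \<and> A \<noteq> {} \<and> B \<noteq> {} \<and> card A = card B \<and> card B \<le> N}.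
        ennreal (norm (\<Sum>n\<in>A. e n) / norm (\<Sum>n\<in>B. e n)))"

end

theory Submission imports Defs begin

text \<open>
  Lower bounds: replacing the coefficients of \<open>x\<close> on a set of \<open>N\<close> indices by a large constant
  makes that set greedy. If the given set has fewer than \<open>N\<close> elements, it is padded with far-out
  indices, where the projection of \<open>x\<close> is small since \<open>es n x \<longlonglongrightarrow> 0\<close>.

  Upper bounds: let \<open>L\<close> be greedy for \<open>x\<close>, let \<open>z\<close> be supported in \<open>A\<close> and \<open>w = x - z\<close>. Then
  \<open>x - P\<^sub>L x = (I - P\<^sub>A\<^sub>\<union>\<^sub>L) w + P\<^sub>A\<^sub>-\<^sub>L x\<close>, and \<open>I - P\<^sub>L\<^sub>-\<^sub>A\<close> replaces \<open>I - P\<^sub>A\<^sub>\<union>\<^sub>L\<close> when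
  \<open>z = P\<^sub>A x\<close>. The coefficients of \<open>x\<close> on \<open>A - L\<close> are at most \<open>r\<close>, the smallest modulus of a
  coefficient on \<open>L\<close>; so, up to a factor \<open>c\<close> (2 for real and 4 for complex scalars), the last
  term is at most \<open>r\<close> times the norm of an indicator sum over a subset of \<open>A - L\<close>, hence at most
  \<open>r * mu\<close> times that over some \<open>B \<subseteq> L - A\<close> of the same size. The signs of \<open>w\<close> on \<open>B\<close> are
  inserted at the cost of another \<open>c\<close>, \<open>B\<close> is enlarged to \<open>{n. r \<le> \<bar>es n w\<bar>}\<close> at the cost of
  \<open>q\<close>, and \<open>r\<close> times the resulting signed sum is at most \<open>2 * q * norm w\<close> by Abel summation
  over the greedy sums of \<open>w\<close>.
\<close>

section \<open>Weighted sums bounded by sums over level sets and over subsets\<close>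

text \<open>Abel summation in layer form: a weight with values between 0 and \<open>T\<close> is a
  superposition of indicators of its level sets, of total mass at most \<open>T\<close>. The
  induction peels off the lowest layer.\<close>

lemma norm_sum_scaleR_le_level_sums:
  fixes t :: "'i \<Rightarrow> real" and v :: "'i \<Rightarrow> 'a::real_normed_vector"
  assumes "finite L" "\<And>n. n \<in> L \<Longrightarrow> 0 \<le> t n \<and> t n \<le> T" "0 \<le> T" "0 \<le> M"
    and "\<And>s. 0 < s \<Longrightarrow> norm (\<Sum>n\<in>{n\<in>L. s \<le> t n}. v n) \<le> M"
  shows "norm (\<Sum>n\<in>L. t n *\<^sub>R v n) \<le> T * M"
  using assms
proof (induction "card L" arbitrary: L t T rule: less_induct)
  case less
  show ?case
  proof (cases "L = {}")
    case True
    then show ?thesis using less.prems by simp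
  next
    case False
    define m where "m = Min (t ` L)"
    have fin: "finite (t ` L)" "t ` L \<noteq> {}" using less.prems(1) False by auto
    obtain n0 where n0: "n0 \<in> L" "t n0 = m" using Min_in[OF fin] unfolding m_def by auto
    have mle: "m \<le> t n" if "n \<in> L" for n using that fin unfolding m_def by simp
    have m0: "0 \<le> m" "m \<le> T" using less.prems(2)[OF n0(1)] n0(2) by auto
    define L' where "L' = {n\<in>L. m < t n}"
    have L': "finite L'" "L' \<subseteq> L" using less.prems(1) unfolding L'_def by auto
    have "n0 \<notin> L'" unfolding L'_def using n0 by simp
    then have "card L' < card L" using L' n0(1) less.prems(1) by (intro psubset_card_mono) auto
    \<comment> \<open>Subtracting the minimum \<open>m\<close> deletes at least \<open>n0\<close>,
      lowers the ceiling to \<open>T - m\<close> and shifts the level sets by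
      \<open>m\<close>.\<close>
    then have 1: "norm (\<Sum>n\<in>L'. (t n - m) *\<^sub>R v n) \<le> (T - m) * M"
    proof (rule less.hyps)
      fix s :: real assume s: "0 < s"
      have "{n \<in> L'. s \<le> t n - m} = {n\<in>L. s + m \<le> t n}"
        unfolding L'_def using s by auto
      then show "norm (\<Sum>n\<in>{n \<in> L'. s \<le> t n - m}. v n) \<le> M"
        using less.prems(5)[of "s + m"] s m0 by simp
    qed (use L' less.prems m0 in \<open>auto simp: L'_def\<close>)
    have 2: "norm (m *\<^sub>R (\<Sum>n\<in>L. v n)) \<le> m * M"
    \<comment> \<open>Level sums are controlled for \<open>0 < s\<close> only; for
      \<open>m = 0\<close> the layer is zero anyway.\<close>
    proof (cases "m = 0")
      case False
      then have "0 < m" using m0 by simp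
      moreover have "{n\<in>L. m \<le> t n} = L" using mle by auto
      ultimately have "norm (\<Sum>n\<in>L. v n) \<le> M" using less.prems(5)[of m] by simp
      then show ?thesis using m0 by (simp add: mult_left_mono)
    qed simp
    have "(\<Sum>n\<in>L'. (t n - m) *\<^sub>R v n) = (\<Sum>n\<in>L. (t n - m) *\<^sub>R v n)"
    proof (rule sum.mono_neutral_left)
      show "\<forall>n\<in>L - L'. (t n - m) *\<^sub>R v n = 0" unfolding L'_def using mle by force
    qed (use L' less.prems in auto)
    then have "(\<Sum>n\<in>L. t n *\<^sub>R v n) = (\<Sum>n\<in>L'. (t n - m) *\<^sub>R v n) + m *\<^sub>R (\<Sum>n\<in>L. v n)"
      by (simp add: scaleR_sum_right scaleR_left_diff_distrib sum_subtractf)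
    then have "norm (\<Sum>n\<in>L. t n *\<^sub>R v n) \<le> (T - m) * M + m * M"
      using norm_triangle_mono[OF 1 2] by simp
    then show ?thesis by (simp add: algebra_simps)
  qed
qed

text \<open>The positive and negative parts of \<open>a\<close> are weights between 0 and 1 whose
  level sets are subsets of \<open>A\<close>; each part costs one \<open>S\<close>.\<close>

lemma norm_sum_scaleR_le_subset_sums:
  fixes f :: "'i \<Rightarrow> 'a::real_normed_vector"
  assumes "finite A" "\<forall>n\<in>A. \<bar>a n\<bar> \<le> 1" "\<forall>A'\<subseteq>A. norm (sum f A') \<le> S"
  shows "norm (\<Sum>n\<in>A. a n *\<^sub>R f n) \<le> 2 * S"
proof -
  have S0: "0 \<le> S" using assms(3) by (metis empty_subsetI norm_zero sum.empty)
  have part: "norm (\<Sum>n\<in>A. t n *\<^sub>R f n) \<le> S" if "\<And>n. n \<in> A \<Longrightarrow> 0 \<le> t n \<and> t n \<le> 1" for t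
  proof -
    have "norm (\<Sum>n\<in>A. t n *\<^sub>R f n) \<le> 1 * S"
      by (rule norm_sum_scaleR_le_level_sums) (use assms that S0 in auto)
    then show ?thesis by simp
  qed
  have "a n = max (a n) 0 - max (- a n) 0" for n by simp
  then have eq: "(\<Sum>n\<in>A. a n *\<^sub>R f n)
      = (\<Sum>n\<in>A. max (a n) 0 *\<^sub>R f n) - (\<Sum>n\<in>A. max (- a n) 0 *\<^sub>R f n)"
    by (simp only: sum_subtractf[symmetric] scaleR_left_diff_distrib[symmetric])
  have "norm (\<Sum>n\<in>A. max (a n) 0 *\<^sub>R f n) \<le> S"
    by (rule part) (use assms(2) in auto)
  moreover have "norm (\<Sum>n\<in>A. max (- a n) 0 *\<^sub>R f n) \<le> S"
    by (rule part) (use assms(2) in force)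
  ultimately show ?thesis unfolding eq
    using norm_triangle_ineq4[of "\<Sum>n\<in>A. max (a n) 0 *\<^sub>R f n" "\<Sum>n\<in>A. max (- a n) 0 *\<^sub>R f n"]
    by linarith
qed

lemma map_norm_le_ennreal_iff:
  assumes "0 \<le> c" "F 0 = 0"
  shows "map_norm F \<le> ennreal c \<longleftrightarrow> (\<forall>x. norm (F x) \<le> c * norm x)"
proof -
  have "(x \<noteq> 0 \<longrightarrow> norm (F x) / norm x \<le> c) \<longleftrightarrow> norm (F x) \<le> c * norm x" for x
    using assms by (cases "x = 0") (simp_all add: divide_le_eq)
  then show ?thesis
    unfolding map_norm_def SUP_le_iff using assms by simp
qed

section \<open>Coordinates and coordinate projections of a biorthogonal system\<close>

locale biorthogonal_system =
  fixes smul :: "'k::real_normed_field \<Rightarrow> 'a::banach \<Rightarrow> 'a"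
    and e :: "nat \<Rightarrow> 'a" and es :: "nat \<Rightarrow> 'a \<Rightarrow> 'k"
  assumes system: "seminormalized_biorthogonal_system smul e es"
begin

sublocale vector_space smul
  using system unfolding seminormalized_biorthogonal_system_def banach_over_def by blast

abbreviation proj :: "nat set \<Rightarrow> 'a \<Rightarrow> 'a" where "proj \<equiv> coord_proj smul e es"

text \<open>Unlike \<open>greedy_sets\<close>, this leaves the cardinality open, since the proofs
  form greedy sets of varying size, such as unions and differences.\<close>

definition greedy :: "'a \<Rightarrow> nat set \<Rightarrow> bool" where
  "greedy x L \<longleftrightarrow> finite L \<and> (\<forall>n\<in>L. \<forall>m\<in>-L. norm (es m x) \<le> norm (es n x))"

lemma greedy_sets_eq: "greedy_sets es x N = {L. greedy x L \<and> card L = N}"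
  unfolding greedy_sets_def greedy_def by auto

lemma smul_of_real: "smul (of_real r) x = r *\<^sub>R x"
  and norm_smul: "norm (smul c x) = norm c * norm x"
  using system unfolding seminormalized_biorthogonal_system_def banach_over_def by auto

lemma es_hom: "module_hom smul (*) (es n)"
  using system unfolding seminormalized_biorthogonal_system_def
  by (auto dest!: spec[of _ n] simp: Vector_Spaces.linear_def)

lemmas es_simps [simp] =
  module_hom.add[OF es_hom] module_hom.diff[OF es_hom] module_hom.scale[OF es_hom]
  module_hom.zero[OF es_hom]

lemma es_e: "es m (e n) = (if m = n then 1 else 0)"
  using system unfolding seminormalized_biorthogonal_system_def by blast

lemma e_nonzero: "e n \<noteq> 0"
  using es_e[of n n] by auto

lemma uniform_bound:
  obtains K where "0 < K" "\<And>n. norm (e n) \<le> K" "\<And>n x. norm (es n x) \<le> K * norm x"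
proof -
  obtain k K where K: "0 < k" "\<And>n. k \<le> norm (e n)" "\<And>n. norm (e n) \<le> K" "\<And>n. onorm (es n) \<le> K"
    using system unfolding seminormalized_biorthogonal_system_def by blast
  have bl: "bounded_linear (es n)" for n
    using system unfolding seminormalized_biorthogonal_system_def by blast
  have "norm (es n x) \<le> K * norm x" for n x
    using onorm[OF bl, of n x] mult_right_mono[OF K(4)[of n] norm_ge_zero[of x]] by linarith
  moreover have "0 < K" using K(1) K(2)[of 0] K(3)[of 0] by linarith
  ultimately show thesis using that K(3) by blast
qed

lemma es_sum: "finite A \<Longrightarrow> es m (\<Sum>n\<in>A. smul (a n) (e n)) = (if m \<in> A then a m else 0)"
  by (simp add: module_hom.sum[OF es_hom] es_e if_distrib[of "(*) _"] cong: if_cong)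

lemma es_sum_e: "finite A \<Longrightarrow> es m (\<Sum>n\<in>A. e n) = (if m \<in> A then 1 else 0)"
  using es_sum[of A m "\<lambda>_. 1"] by simp

lemma es_proj [simp]: "finite A \<Longrightarrow> es m (proj A x) = (if m \<in> A then es m x else 0)"
  unfolding coord_proj_def by (rule es_sum)

lemma proj_diff: "proj A (x - y) = proj A x - proj A y"
  by (simp add: coord_proj_def scale_left_diff_distrib sum_subtractf)

lemma proj_cong: "(\<And>n. n \<in> A \<Longrightarrow> es n x = es n y) \<Longrightarrow> proj A x = proj A y"
  by (simp add: coord_proj_def)

lemma proj_zero [simp]: "proj A 0 = 0" and proj_empty [simp]: "proj {} x = 0"
  by (simp_all add: coord_proj_def)

lemma proj_Un: "finite A \<Longrightarrow> finite B \<Longrightarrow> A \<inter> B = {} \<Longrightarrow> proj (A \<union> B) x = proj A x + proj B x"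
  unfolding coord_proj_def by (rule sum.union_disjoint)

lemma proj_sum:
  assumes "finite A" "finite B"
  shows "proj A (\<Sum>n\<in>B. smul (a n) (e n)) = (\<Sum>n\<in>A \<inter> B. smul (a n) (e n))"
  unfolding coord_proj_def
  by (intro sum.mono_neutral_cong_right) (use assms in \<open>auto simp: es_sum\<close>)

section \<open>Decay of coefficients, greedy sets and greedy operators\<close>

text \<open>Vectors in the span have only finitely many nonzero coefficients, the span is dense, and
  the functionals are uniformly bounded.\<close>

lemma es_tendsto_zero: "(\<lambda>n. es n x) \<longlonglongrightarrow> 0"
proof (rule LIMSEQ_I)
  fix r :: real assume r: "0 < r"
  obtain K where K: "0 < K" "\<And>n x. norm (es n x) \<le> K * norm x" using uniform_bound by metis
  have "x \<in> closure (span (range e))"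
    using system unfolding seminormalized_biorthogonal_system_def by blast
  then obtain y where y: "y \<in> span (range e)" "dist y x < r / K"
    using r K(1) unfolding closure_approachable by (meson divide_pos_pos)
  have "span (range e) \<subseteq> {y. \<exists>M. \<forall>n\<ge>M. es n y = 0}"
  proof (rule span_minimal)
    show "range e \<subseteq> {y. \<exists>M. \<forall>n\<ge>M. es n y = 0}"
    proof clarify
      fix m show "\<exists>M. \<forall>n\<ge>M. es n (e m) = 0" by (rule exI[of _ "Suc m"]) (simp add: es_e)
    qed
    show "subspace {y. \<exists>M. \<forall>n\<ge>M. es n y = 0}"
    proof (rule subspaceI)
      fix u v assume "u \<in> {y. \<exists>M. \<forall>n\<ge>M. es n y = 0}" "v \<in> {y. \<exists>M. \<forall>n\<ge>M. es n y = 0}"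
      then obtain M1 M2 where "\<forall>n\<ge>M1. es n u = 0" "\<forall>n\<ge>M2. es n v = 0" by auto
      then have "\<forall>n\<ge>max M1 M2. es n (u + v) = 0" by simp
      then show "u + v \<in> {y. \<exists>M. \<forall>n\<ge>M. es n y = 0}" by blast
    qed auto
  qed
  then obtain M where M: "\<And>n. M \<le> n \<Longrightarrow> es n y = 0" using y(1) by auto
  have "norm (es n x - 0) < r" if "M \<le> n" for n
  proof -
    have "norm (es n x) = norm (es n (x - y))" using M[OF that] by simp
    also have "\<dots> \<le> K * norm (x - y)" by (rule K(2))
    also have "\<dots> < r" using y(2) K(1) by (simp add: dist_norm norm_minus_commute field_simps)
    finally show ?thesis by simp
  qed
  then show "\<exists>M. \<forall>n\<ge>M. norm (es n x - 0) < r" by blast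
qed

lemma finite_large_coefficients: "0 < r \<Longrightarrow> finite {n. r \<le> norm (es n x)}"
proof -
  assume "0 < r"
  then obtain M where "\<forall>n\<ge>M. norm (es n x) < r"
    using LIMSEQ_D[OF es_tendsto_zero, of r x] by auto
  then have "{n. r \<le> norm (es n x)} \<subseteq> {..<M}" by (metis (mono_tags) lessThan_iff linorder_not_le mem_Collect_eq subsetI)
  then show ?thesis by (rule finite_subset) simp
qed

text \<open>A greedy set stays greedy when an index with the largest coefficient outside it is
  added.\<close>

lemma greedy_exists: "\<exists>L. greedy x L \<and> card L = N"
proof (induction N)
  case 0
  show ?case by (rule exI[of _ "{}"]) (simp add: greedy_def)
next
  case (Suc N)
  then obtain L where L: "greedy x L" "card L = N" by blast
  then have fin: "finite L" by (simp add: greedy_def)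
  have "\<exists>m\<in>-L. \<forall>n\<in>-L. norm (es n x) \<le> norm (es m x)"
  proof (cases "\<exists>m\<in>-L. es m x \<noteq> 0")
    case True
    then obtain k where k: "k \<in> -L" "es k x \<noteq> 0" by blast
    \<comment> \<open>The complement of \<open>L\<close> is infinite, but only finitely many
      coefficients are as large as the nonzero one at \<open>k\<close>, so a maximum exists.\<close>
    define F where "F = {n\<in>-L. norm (es k x) \<le> norm (es n x)}"
    have "finite F" unfolding F_def
      by (rule finite_subset[OF _ finite_large_coefficients[of "norm (es k x)" x]]) (use k in auto)
    moreover have "F \<noteq> {}" using k unfolding F_def by auto
    ultimately have "Max ((\<lambda>n. norm (es n x)) ` F) \<in> (\<lambda>n. norm (es n x)) ` F" by simp
    then obtain m where "m \<in> F" "norm (es m x) = Max ((\<lambda>n. norm (es n x)) ` F)" by auto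
    then have m: "m \<in> F" "\<And>n. n \<in> F \<Longrightarrow> norm (es n x) \<le> norm (es m x)"
      using \<open>finite F\<close> by simp_all
    have "norm (es n x) \<le> norm (es m x)" if "n \<in> -L" for n
    proof (cases "n \<in> F")
      case False
      then have "norm (es n x) \<le> norm (es k x)" using that unfolding F_def by simp
      also have "\<dots> \<le> norm (es m x)" using m(1) unfolding F_def by simp
      finally show ?thesis .
    qed (rule m(2))
    then show ?thesis using m(1) unfolding F_def by blast
  next
    case False
    obtain m where "m \<notin> L" using ex_new_if_finite[OF infinite_UNIV_nat fin] by blast
    then show ?thesis using False by (intro bexI[of _ m]) auto
  qed
  then obtain m where m: "m \<notin> L" "\<And>n. n \<notin> L \<Longrightarrow> norm (es n x) \<le> norm (es m x)" by auto
  have "greedy x (insert m L)" using L m unfolding greedy_def by auto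
  moreover have "card (insert m L) = Suc N" using fin m(1) L by simp
  ultimately show ?case by blast
qed

text \<open>An operator chooses a greedy set at every vector: \<open>L\<close> is prescribed at
  \<open>x\<close> and the choice is arbitrary elsewhere. Bounds on operators thus become bounds on
  single greedy sets.\<close>

lemma greedy_op_through:
  assumes "greedy x L"
  obtains G where "G \<in> greedy_ops smul e es (card L)" "G x = proj L x"
proof -
  define S where "S y = (if y = x then L else (SOME L'. greedy y L' \<and> card L' = card L))" for y
  have "greedy y (S y) \<and> card (S y) = card L" for y
    unfolding S_def using assms someI_ex[OF greedy_exists] by auto
  then have "(\<lambda>y. proj (S y) y) \<in> greedy_ops smul e es (card L)"
    unfolding greedy_ops_def greedy_sets_eq by auto
  moreover have "proj (S x) x = proj L x" unfolding S_def by simp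
  ultimately show thesis using that by blast
qed

lemma greedy_opE:
  assumes "G \<in> greedy_ops smul e es N"
  obtains L where "greedy x L" "card L = N" "G x = proj L x"
  using assms unfolding greedy_ops_def greedy_sets_eq by auto

lemma greedy_op_zero: "G \<in> greedy_ops smul e es N \<Longrightarrow> G 0 = 0"
  unfolding greedy_ops_def by auto

text \<open>Provides the padding for sets with fewer than \<open>N\<close> elements, at arbitrarily
  small cost.\<close>

lemma distant_indices:
  assumes "finite A" "0 < r"
  obtains C where "finite C" "card C = k" "C \<inter> A = {}" "norm (proj C x) \<le> r"
proof -
  obtain K where K: "0 < K" "\<And>n. norm (e n) \<le> K" using uniform_bound by metis
  \<comment> \<open>Each of the \<open>k\<close> terms will have norm at most \<open>d * K\<close>,
    in total at most \<open>r\<close>; the summand 1 keeps the denominator positive for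
    \<open>k = 0\<close>.\<close>
  define d where "d = r / (K * (real k + 1))"
  have d: "0 < d" using assms(2) K(1) unfolding d_def by (simp add: divide_pos_pos mult_pos_pos)
  obtain M where M: "\<And>n. M \<le> n \<Longrightarrow> norm (es n x) < d"
    using LIMSEQ_D[OF es_tendsto_zero d, of x] by auto
  obtain M' where M': "\<And>n. n \<in> A \<Longrightarrow> n < M'" using assms(1) finite_nat_set_iff_bounded by auto
  define C where "C = {M + M'..<M + M' + k}"
  have "norm (proj C x) \<le> (\<Sum>n\<in>C. d * K)" unfolding coord_proj_def
  proof (rule sum_norm_le)
    fix n assume "n \<in> C"
    then have "norm (es n x) \<le> d" using M[of n] unfolding C_def by simp
    then show "norm (smul (es n x) (e n)) \<le> d * K"
      unfolding norm_smul using K d by (intro mult_mono) auto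
  qed
  also have "\<dots> = k * (d * K)" unfolding C_def by simp
  also have "\<dots> \<le> d * (K * (real k + 1))" using d K(1) by (simp add: algebra_simps)
  also have "\<dots> = r" using K(1) unfolding d_def by simp
  finally have "norm (proj C x) \<le> r" .
  moreover have "C \<inter> A = {}" using M' unfolding C_def by fastforce
  ultimately show thesis using that[of C] unfolding C_def by simp
qed

section \<open>The constants expressed by real inequalities\<close>

lemma sum_e_nonzero: "finite B \<Longrightarrow> B \<noteq> {} \<Longrightarrow> (\<Sum>n\<in>B. e n) \<noteq> 0"
  using es_sum_e by (metis all_not_in_conv es_simps(4) zero_neq_one)

text \<open>Denominators can be cleared because indicator sums over nonempty sets are nonzero. The
  empty pair, excluded in \<open>mu_const\<close>, satisfies the inequality trivially.\<close>

lemma mu_const_le_iff: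
  assumes "0 \<le> c"
  shows "mu_const e N \<le> ennreal c \<longleftrightarrow>
    (\<forall>A B. finite A \<and> finite B \<and> card A = card B \<and> card B \<le> N \<longrightarrow>
      norm (\<Sum>n\<in>A. e n) \<le> c * norm (\<Sum>n\<in>B. e n))" (is "_ \<longleftrightarrow> ?R")
proof -
  have "mu_const e N \<le> ennreal c \<longleftrightarrow>
    (\<forall>A B. finite A \<and> finite B \<and> A \<noteq> {} \<and> B \<noteq> {} \<and> card A = card B \<and> card B \<le> N \<longrightarrow>
      norm (\<Sum>n\<in>A. e n) / norm (\<Sum>n\<in>B. e n) \<le> c)" (is "_ \<longleftrightarrow> ?Q")
    unfolding mu_const_def SUP_le_iff using assms by auto
  also have "?Q \<longleftrightarrow> ?R"
  proof
    assume ?Q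
    show ?R
    proof (intro allI impI)
      fix A B :: "nat set" assume AB: "finite A \<and> finite B \<and> card A = card B \<and> card B \<le> N"
      show "norm (\<Sum>n\<in>A. e n) \<le> c * norm (\<Sum>n\<in>B. e n)"
      proof (cases "B = {}")
        case True then show ?thesis using AB by auto
      next
        case False
        then have "A \<noteq> {}" using AB by auto
        then have "norm (\<Sum>n\<in>A. e n) / norm (\<Sum>n\<in>B. e n) \<le> c" using \<open>?Q\<close> AB False by blast
        then show ?thesis using sum_e_nonzero[of B] False AB by (simp add: divide_le_eq)
      qed
    qed
  next
    assume ?R
    then show ?Q using sum_e_nonzero by (auto simp: divide_le_eq)
  qed
  finally show ?thesis .
qed

text \<open>Applying \<open>es m\<close> for some \<open>m \<in> B\<close> bounds the denominator
  below by \<open>1 / K\<close>, while the numerator is at most \<open>N * K\<close>.\<close>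

lemma mu_const_finite: "mu_const e N < \<infinity>"
proof -
  obtain K where K: "0 < K" "\<And>n. norm (e n) \<le> K" "\<And>n x. norm (es n x) \<le> K * norm x"
    using uniform_bound by metis
  have "mu_const e N \<le> ennreal (N * K * K)"
  proof (subst mu_const_le_iff, simp add: K(1) less_imp_le, intro allI impI)
    fix A B :: "nat set" assume AB: "finite A \<and> finite B \<and> card A = card B \<and> card B \<le> N"
    show "norm (\<Sum>n\<in>A. e n) \<le> N * K * K * norm (\<Sum>n\<in>B. e n)"
    proof (cases "B = {}")
      case True then show ?thesis using AB by auto
    next
      case False
      then obtain m where "m \<in> B" by blast
      then have 1: "1 \<le> K * norm (\<Sum>n\<in>B. e n)"
        using K(3)[of m "\<Sum>n\<in>B. e n"] AB by (simp add: es_sum_e)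
      have "norm (\<Sum>n\<in>A. e n) \<le> card A * K"
        using sum_norm_le[of A e "\<lambda>_. K"] K(2) by simp
      also have "\<dots> \<le> N * K" using AB K(1) by simp
      also have "\<dots> \<le> N * K * (K * norm (\<Sum>n\<in>B. e n))"
        using mult_left_mono[OF 1, of "N * K"] K(1) by simp
      finally show ?thesis by (simp add: mult.assoc)
    qed
  qed
  then show ?thesis by (simp add: le_less_trans)
qed

lemma mu_const_ge_one: "1 \<le> N \<Longrightarrow> 1 \<le> mu_const e N"
proof -
  assume "1 \<le> N"
  then have "ennreal (norm (\<Sum>n\<in>{0}. e n) / norm (\<Sum>n\<in>{0}. e n)) \<le> mu_const e N"
    unfolding mu_const_def by (intro SUP_upper2[of "({0}, {0})"]) auto
  then show ?thesis using e_nonzero[of 0] by simp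
qed

lemma kc_const_le_iff:
  assumes "0 \<le> c"
  shows "kc_const smul e es N \<le> ennreal c \<longleftrightarrow>
    (\<forall>A x. finite A \<and> card A \<le> N \<longrightarrow> norm (x - proj A x) \<le> c * norm x)"
  unfolding kc_const_def SUP_le_iff using assms by (auto simp: map_norm_le_ennreal_iff)

text \<open>By \<open>greedy_op_through\<close>, every greedy set is the choice of some operator at
  the given vector. \<open>S\<close> will be \<open>{1..N}\<close> for \<open>gc_const\<close> and
  \<open>{1..}\<close> for the quasi-greedy constant.\<close>

lemma map_norm_greedy_ops_le_iff:
  assumes "0 \<le> c"
  shows "(\<forall>k\<in>S. \<forall>G\<in>greedy_ops smul e es k. map_norm G \<le> ennreal c)
      \<longleftrightarrow> (\<forall>L x. greedy x L \<and> card L \<in> S \<longrightarrow> norm (proj L x) \<le> c * norm x)" (is "?l1 \<longleftrightarrow> ?r1")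
    and "(\<forall>k\<in>S. \<forall>G\<in>greedy_ops smul e es k. map_norm (\<lambda>x. x - G x) \<le> ennreal c)
      \<longleftrightarrow> (\<forall>L x. greedy x L \<and> card L \<in> S \<longrightarrow> norm (x - proj L x) \<le> c * norm x)" (is "?l2 \<longleftrightarrow> ?r2")
proof -
  have "map_norm G \<le> ennreal c \<longleftrightarrow> (\<forall>x. norm (G x) \<le> c * norm x)"
    and "map_norm (\<lambda>x. x - G x) \<le> ennreal c \<longleftrightarrow> (\<forall>x. norm (x - G x) \<le> c * norm x)"
    if "G \<in> greedy_ops smul e es k" for G k
    using greedy_op_zero[OF that] by (simp_all add: map_norm_le_ennreal_iff assms)
  then have l: "?l1 \<longleftrightarrow> (\<forall>k\<in>S. \<forall>G\<in>greedy_ops smul e es k. \<forall>x. norm (G x) \<le> c * norm x)"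
    "?l2 \<longleftrightarrow> (\<forall>k\<in>S. \<forall>G\<in>greedy_ops smul e es k. \<forall>x. norm (x - G x) \<le> c * norm x)"
    by simp_all
  have *: "(\<forall>k\<in>S. \<forall>G\<in>greedy_ops smul e es k. \<forall>x. Q x (G x)) \<longleftrightarrow>
      (\<forall>L x. greedy x L \<and> card L \<in> S \<longrightarrow> Q x (proj L x))" (is "?l \<longleftrightarrow> ?r") for Q
  proof
    assume l: ?l
    show ?r
    proof (intro allI impI, elim conjE)
      fix L x assume L: "greedy x L" "card L \<in> S"
      obtain G where G: "G \<in> greedy_ops smul e es (card L)" "G x = proj L x"
        using greedy_op_through[OF L(1)] by blast
      have "Q x (G x)" using l L(2) G(1) by blast
      then show "Q x (proj L x)" unfolding G(2) .
    qed
  next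
    assume r: ?r
    show ?l
    proof (intro ballI allI)
      fix k G x assume k: "k \<in> S" "G \<in> greedy_ops smul e es k"
      obtain L where "greedy x L" "card L = k" "G x = proj L x" using k(2) by (rule greedy_opE)
      then show "Q x (G x)" using r k(1) by simp
    qed
  qed
  show "?l1 \<longleftrightarrow> ?r1" "?l2 \<longleftrightarrow> ?r2" unfolding l by (fact *)+
qed

lemma sigma_err_le:
  assumes "finite A" "card A \<le> N"
  shows "sigma_err smul e N x \<le> norm (x - (\<Sum>n\<in>A. smul (a n) (e n)))"
  using assms unfolding sigma_err_def dist_norm[symmetric]
  by (intro infdist_le) (auto simp: Sigma_set_def)

lemma sigma_tilde_err_le:
  assumes "finite A" "card A \<le> N"
  shows "sigma_tilde_err smul e es N x \<le> norm (x - proj A x)"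
  using assms unfolding sigma_tilde_err_def
  by (intro cINF_lower bdd_belowI[of _ 0]) auto

lemma sigma_err_geI:
  assumes "\<And>A a. finite A \<Longrightarrow> card A \<le> N \<Longrightarrow> r \<le> norm (x - (\<Sum>n\<in>A. smul (a n) (e n)))"
  shows "r \<le> sigma_err smul e N x"
proof -
  \<comment> \<open>The empty sum shows nonemptiness; on the empty set \<open>infdist\<close> is 0
    by convention and not an infimum.\<close>
  have "(\<Sum>n\<in>{}. smul 0 (e n)) \<in> Sigma_set smul e N"
    unfolding Sigma_set_def by force
  then have ne: "Sigma_set smul e N \<noteq> {}" by blast
  show ?thesis unfolding sigma_err_def infdist_notempty[OF ne]
    by (intro cINF_greatest ne) (use assms in \<open>auto simp: Sigma_set_def dist_norm\<close>)
qed

lemma sigma_tilde_err_geI: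
  assumes "\<And>A. finite A \<Longrightarrow> card A \<le> N \<Longrightarrow> r \<le> norm (x - proj A x)"
  shows "r \<le> sigma_tilde_err smul e es N x"
  unfolding sigma_tilde_err_def
  by (intro cINF_greatest) (use assms in \<open>auto intro: exI[of _ "{}"]\<close>)

text \<open>An infinite admissible constant needs no argument. A finite one is a real
  \<open>c\<close> that works against every competitor, since the error is at most the distance to
  it.\<close>

lemma lebesgue_const_geI:
  assumes "\<And>c. 0 \<le> c \<Longrightarrow>
      (\<And>x L A a. greedy x L \<Longrightarrow> card L = N \<Longrightarrow> finite A \<Longrightarrow> card A \<le> N \<Longrightarrow>
        norm (x - proj L x) \<le> c * norm (x - (\<Sum>n\<in>A. smul (a n) (e n)))) \<Longrightarrow> K \<le> ennreal c"
  shows "K \<le> lebesgue_const smul e es N"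
  unfolding lebesgue_const_def
proof (rule Inf_greatest, clarify)
  fix C assume C: "\<forall>x. \<forall>G\<in>greedy_ops smul e es N.
      ennreal (norm (x - G x)) \<le> C * ennreal (sigma_err smul e N x)"
  show "K \<le> C"
  proof (cases C)
    case (real c)
    show ?thesis unfolding real
    proof (rule assms[OF real(1)])
      fix x L A a assume *: "greedy x L" "card L = N" "finite (A :: nat set)" "card A \<le> N"
      obtain G where G: "G \<in> greedy_ops smul e es N" "G x = proj L x"
        using greedy_op_through[OF *(1)] *(2) by blast
      have "ennreal (norm (x - proj L x)) \<le> ennreal (c * sigma_err smul e N x)"
        using C G real by (metis ennreal_mult infdist_nonneg sigma_err_def)
      then have "norm (x - proj L x) \<le> c * sigma_err smul e N x"
        using real(1) by (simp add: sigma_err_def infdist_nonneg)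
      also have "\<dots> \<le> c * norm (x - (\<Sum>n\<in>A. smul (a n) (e n)))"
        by (intro mult_left_mono sigma_err_le * real)
      finally show "norm (x - proj L x) \<le> c * norm (x - (\<Sum>n\<in>A. smul (a n) (e n)))" .
    qed
  qed simp
qed

lemma lebesgue_tilde_const_geI:
  assumes "\<And>c. 0 \<le> c \<Longrightarrow>
      (\<And>x L A. greedy x L \<Longrightarrow> card L = N \<Longrightarrow> finite A \<Longrightarrow> card A \<le> N \<Longrightarrow>
        norm (x - proj L x) \<le> c * norm (x - proj A x)) \<Longrightarrow> K \<le> ennreal c"
  shows "K \<le> lebesgue_tilde_const smul e es N"
  unfolding lebesgue_tilde_const_def
proof (rule Inf_greatest, clarify)
  have nonneg: "0 \<le> sigma_tilde_err smul e es N x" for x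
    by (rule sigma_tilde_err_geI) simp
  fix C assume C: "\<forall>x. \<forall>G\<in>greedy_ops smul e es N.
      ennreal (norm (x - G x)) \<le> C * ennreal (sigma_tilde_err smul e es N x)"
  show "K \<le> C"
  proof (cases C)
    case (real c)
    show ?thesis unfolding real
    proof (rule assms[OF real(1)])
      fix x L A assume *: "greedy x L" "card L = N" "finite (A :: nat set)" "card A \<le> N"
      obtain G where G: "G \<in> greedy_ops smul e es N" "G x = proj L x"
        using greedy_op_through[OF *(1)] *(2) by blast
      have "ennreal (norm (x - proj L x)) \<le> ennreal (c * sigma_tilde_err smul e es N x)"
        using C G real nonneg by (metis ennreal_mult)
      then have "norm (x - proj L x) \<le> c * sigma_tilde_err smul e es N x"
        using real(1) nonneg by simp
      also have "\<dots> \<le> c * norm (x - proj A x)"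
        by (intro mult_left_mono sigma_tilde_err_le * real)
      finally show "norm (x - proj L x) \<le> c * norm (x - proj A x)" .
    qed
  qed simp
qed

lemma lebesgue_const_leI:
  assumes "0 \<le> c" and "\<And>x L A a. greedy x L \<Longrightarrow> card L = N \<Longrightarrow> finite A \<Longrightarrow> card A \<le> N \<Longrightarrow>
      norm (x - proj L x) \<le> c * norm (x - (\<Sum>n\<in>A. smul (a n) (e n)))"
  shows "lebesgue_const smul e es N \<le> ennreal c"
  unfolding lebesgue_const_def
proof (rule Inf_lower, clarify)
  fix x G assume "G \<in> greedy_ops smul e es N"
  then obtain L where L: "greedy x L" "card L = N" "G x = proj L x" by (rule greedy_opE)
  have "norm (x - G x) \<le> c * sigma_err smul e N x"
  \<comment> \<open>Division by \<open>c\<close> is impossible for \<open>c = 0\<close>; there the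
    zero competitor, \<open>A = {}\<close>, already makes the left side vanish.\<close>
  proof (cases "c = 0")
    case True
    then show ?thesis using assms(2)[of x L "{}"] L by simp
  next
    case False
    then have "norm (x - G x) / c \<le> sigma_err smul e N x"
      by (intro sigma_err_geI) (use assms L in \<open>simp add: divide_le_eq mult.commute\<close>)
    then show ?thesis using False assms(1) by (simp add: divide_le_eq mult.commute)
  qed
  then show "ennreal (norm (x - G x)) \<le> ennreal c * ennreal (sigma_err smul e N x)"
    using assms(1) by (simp add: ennreal_mult[symmetric] ennreal_leI sigma_err_def infdist_nonneg)
qed

lemma lebesgue_tilde_const_leI:
  assumes "0 \<le> c" and "\<And>x L A. greedy x L \<Longrightarrow> card L = N \<Longrightarrow> finite A \<Longrightarrow> card A \<le> N \<Longrightarrow>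
      norm (x - proj L x) \<le> c * norm (x - proj A x)"
  shows "lebesgue_tilde_const smul e es N \<le> ennreal c"
  unfolding lebesgue_tilde_const_def
proof (rule Inf_lower, clarify)
  fix x G assume "G \<in> greedy_ops smul e es N"
  then obtain L where L: "greedy x L" "card L = N" "G x = proj L x" by (rule greedy_opE)
  have "norm (x - G x) \<le> c * sigma_tilde_err smul e es N x"
  proof (cases "c = 0")
    case True
    then show ?thesis using assms(2)[of x L "{}"] L by simp
  next
    case False
    then have "norm (x - G x) / c \<le> sigma_tilde_err smul e es N x"
      by (intro sigma_tilde_err_geI) (use assms L in \<open>simp add: divide_le_eq mult.commute\<close>)
    then show ?thesis using False assms(1) by (simp add: divide_le_eq mult.commute)
  qed
  moreover have "0 \<le> sigma_tilde_err smul e es N x" by (rule sigma_tilde_err_geI) simp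
  ultimately show "ennreal (norm (x - G x)) \<le> ennreal c * ennreal (sigma_tilde_err smul e es N x)"
    using assms(1) by (simp add: ennreal_mult[symmetric] ennreal_leI)
qed

section \<open>Lower bounds for the Lebesgue constants\<close>

lemma lebesgue_tilde_const_le_lebesgue_const:
  "lebesgue_tilde_const smul e es N \<le> lebesgue_const smul e es N"
proof (rule lebesgue_const_geI)
  fix c :: real
  assume "0 \<le> c" and c: "\<And>x L A a. greedy x L \<Longrightarrow> card L = N \<Longrightarrow> finite A \<Longrightarrow> card A \<le> N \<Longrightarrow>
    norm (x - proj L x) \<le> c * norm (x - (\<Sum>n\<in>A. smul (a n) (e n)))"
  then show "lebesgue_tilde_const smul e es N \<le> ennreal c"
    by (intro lebesgue_tilde_const_leI) (simp_all add: coord_proj_def)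
qed

text \<open>Removes the padding from the estimates below: \<open>proj C x\<close> can be made as
  small as desired, so its contribution disappears in the limit.\<close>

lemma norm_le_of_distant_perturbation:
  assumes "finite A" "0 \<le> c"
    and "\<And>C. finite C \<Longrightarrow> card C = k \<Longrightarrow> C \<inter> A = {} \<Longrightarrow>
      norm (y - proj C x) \<le> c * (norm x + norm (proj C x))"
  shows "norm y \<le> c * norm x"
proof (rule field_le_epsilon)
  fix r :: real assume r: "0 < r"
  \<comment> \<open>The padding enters with factor \<open>c\<close> through the hypothesis and once
    more through the triangle inequality.\<close>
  have "0 < r / (c + 1)" using r assms(2) by simp
  then obtain C where C: "finite C" "card C = k" "C \<inter> A = {}" "norm (proj C x) \<le> r / (c + 1)"
    using distant_indices[OF assms(1)] by blast
  have "norm y \<le> norm (y - proj C x) + norm (proj C x)"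
    by (metis diff_add_cancel norm_triangle_ineq)
  also have "\<dots> \<le> c * norm x + (c + 1) * norm (proj C x)"
    using assms(3)[OF C(1-3)] by (simp add: algebra_simps)
  also have "\<dots> \<le> c * norm x + r"
    using C(4) assms(2) by (simp add: pos_le_divide_eq mult.commute)
  finally show "norm y \<le> c * norm x + r" .
qed

text \<open>The competitor for the modified vector \<open>y\<close> is the modification itself:
  subtracting it gives back \<open>x\<close>, while removing the greedy set \<open>D\<close> gives
  \<open>x - proj D x\<close>.\<close>

lemma kc_const_le_lebesgue_const: "kc_const smul e es N \<le> lebesgue_const smul e es N"
proof (rule lebesgue_const_geI)
  fix c :: real
  assume c0: "0 \<le> c" and c: "\<And>x L A a. greedy x L \<Longrightarrow> card L = N \<Longrightarrow> finite A \<Longrightarrow> card A \<le> N \<Longrightarrow>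
    norm (x - proj L x) \<le> c * norm (x - (\<Sum>n\<in>A. smul (a n) (e n)))"
  obtain K where K: "0 < K" "\<And>n x. norm (es n x) \<le> K * norm x" using uniform_bound by metis
  show "kc_const smul e es N \<le> ennreal c"
  proof (subst kc_const_le_iff[OF c0], intro allI impI, elim conjE)
    fix A :: "nat set" and x assume A: "finite A" "card A \<le> N"
    show "norm (x - proj A x) \<le> c * norm x"
    proof (rule norm_le_of_distant_perturbation[OF A(1) c0, where k = "N - card A"])
      fix C :: "nat set" assume C: "finite C" "card C = N - card A" "C \<inter> A = {}"
      define D where "D = A \<union> C"
      have D: "finite D" "card D = N" unfolding D_def using A C by (auto simp: card_Un_disjoint Int_commute)
      \<comment> \<open>\<open>K * norm x\<close> dominates every coefficient of \<open>x\<close>,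
        which makes \<open>D\<close> greedy for \<open>y\<close>.\<close>
      define s :: 'k where "s = of_real (K * norm x)"
      define y where "y = x - (\<Sum>n\<in>D. smul (es n x - s) (e n))"
      have es_y: "es n y = (if n \<in> D then s else es n x)" for n
        unfolding y_def using D by (simp add: es_sum)
      have "norm s = K * norm x" unfolding s_def norm_of_real using K(1) by simp
      then have "greedy y D" unfolding greedy_def es_y using D K(2) by auto
      moreover have "y - proj D y = x - proj D x"
        unfolding y_def coord_proj_def using es_y[unfolded y_def]
        by (simp add: scale_left_diff_distrib sum_subtractf)
      moreover have "y - (\<Sum>n\<in>D. smul (s - es n x) (e n)) = x"
        unfolding y_def by (simp add: scale_left_diff_distrib sum_subtractf)
      ultimately have "norm (x - proj D x) \<le> c * norm x"
        using c[of y D D "\<lambda>n. s - es n x"] D by simp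
      moreover have "proj D x = proj A x + proj C x"
        unfolding D_def using A C by (intro proj_Un) auto
      moreover have "c * norm x \<le> c * (norm x + norm (proj C x))"
        using c0 by (intro mult_left_mono) auto
      ultimately show "norm (x - proj A x - proj C x) \<le> c * (norm x + norm (proj C x))"
        by (simp add: diff_diff_eq)
    qed
  qed
qed

lemma gc_const_le_iff:
  assumes "0 \<le> c"
  shows "gc_const smul e es N \<le> ennreal c \<longleftrightarrow>
    (\<forall>L x. greedy x L \<and> card L \<in> {1..N} \<longrightarrow> norm (x - proj L x) \<le> c * norm x)"
  unfolding map_norm_greedy_ops_le_iff(2)[OF assms, symmetric] gc_const_def SUP_le_iff by blast

text \<open>Competitors must now be projections, so only the coefficients on the padding
  \<open>C\<close> are modified and \<open>proj C y\<close> is the competitor. On \<open>L\<close>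
  the coefficients of \<open>x\<close> already dominate those outside \<open>L\<close>.\<close>

lemma gc_const_le_lebesgue_tilde_const: "gc_const smul e es N \<le> lebesgue_tilde_const smul e es N"
proof (rule lebesgue_tilde_const_geI)
  fix c :: real
  assume c0: "0 \<le> c" and c: "\<And>x L A. greedy x L \<Longrightarrow> card L = N \<Longrightarrow> finite A \<Longrightarrow> card A \<le> N \<Longrightarrow>
    norm (x - proj L x) \<le> c * norm (x - proj A x)"
  obtain K where K: "0 < K" "\<And>n x. norm (es n x) \<le> K * norm x" using uniform_bound by metis
  show "gc_const smul e es N \<le> ennreal c"
  proof (subst gc_const_le_iff[OF c0], intro allI impI, elim conjE)
    fix L x assume L: "greedy x L" "card L \<in> {1..N}"
    have finL: "finite L" using L unfolding greedy_def by blast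
    show "norm (x - proj L x) \<le> c * norm x"
    proof (rule norm_le_of_distant_perturbation[OF finL c0, where k = "N - card L"])
      fix C :: "nat set" assume C: "finite C" "card C = N - card L" "C \<inter> L = {}"
      define s :: 'k where "s = of_real (K * norm x)"
      define y where "y = x - (\<Sum>n\<in>C. smul (es n x - s) (e n))"
      have es_y: "es n y = (if n \<in> C then s else es n x)" for n
        unfolding y_def using C by (simp add: es_sum)
      have "norm s = K * norm x" unfolding s_def norm_of_real using K(1) by simp
      then have "greedy y (L \<union> C)" using L C K(2) unfolding greedy_def es_y by auto
      moreover have "card (L \<union> C) = N" using finL C L by (simp add: card_Un_disjoint Int_commute)
      moreover have yC: "y - proj C y = x - proj C x"
        unfolding y_def coord_proj_def using es_y[unfolded y_def]
        by (simp add: scale_left_diff_distrib sum_subtractf)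
      moreover have "proj L y = proj L x" by (rule proj_cong) (use es_y C in auto)
      then have "y - proj (L \<union> C) y = x - proj L x - proj C x"
        using yC proj_Un[of L C y] finL C by (simp add: Int_commute algebra_simps)
      ultimately have "norm (x - proj L x - proj C x) \<le> c * norm (x - proj C x)"
        using c[of y "L \<union> C" C] C by simp
      also have "\<dots> \<le> c * (norm x + norm (proj C x))"
        using c0 by (intro mult_left_mono norm_triangle_ineq4)
      finally show "norm (x - proj L x - proj C x) \<le> c * (norm x + norm (proj C x))" .
    qed
  qed
qed

lemma proj_sum_e:
  "finite A \<Longrightarrow> finite B \<Longrightarrow> proj A (\<Sum>n\<in>B. e n) = (\<Sum>n\<in>A \<inter> B. e n)"
  using proj_sum[of A B "\<lambda>_. 1"] by simp

lemma sum_e_diff_proj: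
  assumes "finite D" "A \<subseteq> D"
  shows "(\<Sum>n\<in>D. e n) - proj (D - A) (\<Sum>n\<in>D. e n) = (\<Sum>n\<in>A. e n)"
proof -
  have "(D - A) \<inter> D = D - A" by blast
  then have "proj (D - A) (\<Sum>n\<in>D. e n) = (\<Sum>n\<in>D - A. e n)" using assms(1) by (simp add: proj_sum_e)
  then show ?thesis using sum.subset_diff[OF assms(2,1), of e] by simp
qed

text \<open>The indicator sum over \<open>D\<close> has coefficients 0 and 1, so every subset of
  \<open>D\<close> is greedy for it. Removing \<open>L\<close> leaves the sum over \<open>A\<close>;
  removing the competitor \<open>D - B\<close> leaves the sum over \<open>B\<close>.\<close>

lemma mu_const_le_lebesgue_tilde_const: "mu_const e N \<le> lebesgue_tilde_const smul e es N"
proof (rule lebesgue_tilde_const_geI)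
  fix c :: real
  assume c0: "0 \<le> c" and c: "\<And>x L A. greedy x L \<Longrightarrow> card L = N \<Longrightarrow> finite A \<Longrightarrow> card A \<le> N \<Longrightarrow>
    norm (x - proj L x) \<le> c * norm (x - proj A x)"
  show "mu_const e N \<le> ennreal c"
  proof (subst mu_const_le_iff[OF c0], intro allI impI, elim conjE)
    fix A B :: "nat set"
    assume AB: "finite A" "finite B" "card A = card B" "card B \<le> N"
    have "card (B - A) \<le> N" using card_Diff_subset_Int[of B A] AB by simp
    moreover have "infinite (- (A \<union> B))" using finite_compl[of "A \<union> B"] AB by (simp del: Compl_Un)
    ultimately obtain C where C: "finite C" "card C = N - card (B - A)" "C \<subseteq> - (A \<union> B)"
      using infinite_arbitrarily_large by blast
    \<comment> \<open>\<open>L\<close> contains \<open>B - A\<close> so that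
      \<open>B \<subseteq> D\<close>, and avoids \<open>A\<close> so that \<open>D - L = A\<close>;
      \<open>C\<close> fills it up to \<open>N\<close> elements.\<close>
    define L where "L = (B - A) \<union> C"
    define D where "D = A \<union> L"
    have "card L = card (B - A) + card C" unfolding L_def
      using AB C by (intro card_Un_disjoint) auto
    then have L: "finite L" "card L = N" "L \<inter> A = {}"
      using AB C \<open>card (B - A) \<le> N\<close> unfolding L_def by auto
    have D: "finite D" "card D = card A + N" "A \<subseteq> D" "B \<subseteq> D" "D - A = L" unfolding D_def
      using L AB by (auto simp: card_Un_disjoint Int_commute L_def)
    have "greedy (\<Sum>n\<in>D. e n) L" unfolding greedy_def using L D by (auto simp: es_sum_e)
    moreover have "card (D - B) = N" using D AB by (simp add: card_Diff_subset)
    ultimately show "norm (\<Sum>n\<in>A. e n) \<le> c * norm (\<Sum>n\<in>B. e n)"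
      using c[of "\<Sum>n\<in>D. e n" L "D - B"] sum_e_diff_proj[of D A] sum_e_diff_proj[of D B] D L by simp
  qed
qed

text \<open>If \<open>q < 1\<close>, removing the basis vectors of \<open>\<Sum>i<n. e i\<close> one at a time forces exponential
  growth of its norm, which is at most linear.\<close>
lemma one_le_greedy_complement_bound:
  assumes q: "\<And>x L. greedy x L \<Longrightarrow> L \<noteq> {} \<Longrightarrow> norm (x - proj L x) \<le> q * norm x"
  shows "1 \<le> q"
proof (rule ccontr)
  assume "\<not> 1 \<le> q"
  then have q1: "q < 1" by simp
  obtain K where K: "\<And>n. norm (e n) \<le> K" using uniform_bound by metis
  define f where "f n = norm (\<Sum>i<n. e i)" for n
  have step: "f n \<le> q * f (Suc n)" for n
  proof -
    have "{..<n} \<subseteq> {..<Suc n}" and diff: "{..<Suc n} - {..<n} = {n}" by auto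
    from sum_e_diff_proj[OF finite_lessThan this(1)]
    have "(\<Sum>i<Suc n. e i) - proj {n} (\<Sum>i<Suc n. e i) = (\<Sum>i<n. e i)" unfolding diff .
    moreover have "greedy (\<Sum>i<Suc n. e i) {n}"
      unfolding greedy_def using es_sum_e[of "{..<Suc n}"] by auto
    ultimately show ?thesis using q[of "\<Sum>i<Suc n. e i" "{n}"] unfolding f_def by simp
  qed
  have f1: "0 < f 1" unfolding f_def using e_nonzero[of 0] by simp
  have "0 \<le> f n" for n unfolding f_def by simp
  then have q0: "0 < q" using step[of 1] f1 by (smt (verit) mult_nonpos_nonneg)
  have iter: "f 1 \<le> q ^ n * f (Suc n)" for n
  proof (induction n)
    case (Suc n)
    have "q ^ n * f (Suc n) \<le> q ^ n * (q * f (Suc (Suc n)))"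
      using step[of "Suc n"] q0 by (intro mult_left_mono) auto
    then show ?case using Suc by (simp add: mult_ac)
  qed simp
  have "f 1 \<le> K * (of_nat n * q ^ n) + K * q ^ n" for n
  proof -
    have "f (Suc n) \<le> Suc n * K"
      unfolding f_def using sum_norm_le[of "{..<Suc n}" e "\<lambda>_. K"] K by simp
    then have "q ^ n * f (Suc n) \<le> q ^ n * (Suc n * K)" using q0 by (intro mult_left_mono) auto
    with iter[of n] have "f 1 \<le> q ^ n * (Suc n * K)" by linarith
    then show ?thesis by (simp add: algebra_simps)
  qed
  \<comment> \<open>Linear growth times geometric decay tends to zero, which contradicts
    \<open>0 < f 1\<close>.\<close>
  moreover have "(\<lambda>n. K * (of_nat n * q ^ n) + K * q ^ n) \<longlonglongrightarrow> K * 0 + K * 0"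
    using q0 q1 by (intro tendsto_intros powser_times_n_limit_0 LIMSEQ_power_zero) auto
  ultimately have "f 1 \<le> K * 0 + K * 0" by (intro LIMSEQ_le_const) auto
  then show False using f1 by simp
qed

section \<open>The quasi-greedy constant as a real number\<close>

text \<open>The minimum is one of the two suprema, hence the disjunction. If the second one is
  smaller, it is finite because the first one is.\<close>

lemma qg_const_real:
  assumes "quasi_greedy smul e es"
  obtains q where "1 \<le> q" "qg_const smul e es = ennreal q"
    "(\<forall>x L. greedy x L \<longrightarrow> norm (proj L x) \<le> q * norm x) \<or>
     (\<forall>x L. greedy x L \<longrightarrow> norm (x - proj L x) \<le> q * norm x)"
proof -
  let ?s1 = "SUP G\<in>all_greedy_ops smul e es. map_norm G"
  let ?s2 = "SUP G\<in>all_greedy_ops smul e es. map_norm (\<lambda>x. x - G x)"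
  have fin: "?s1 < \<infinity>" using assms unfolding quasi_greedy_def .
  have card1: "card L \<in> {1..}" if "greedy x L" "L \<noteq> {}" for L x
    using that unfolding greedy_def by (simp add: card_gt_0_iff Suc_le_eq)
  show thesis
  proof (cases "?s1 \<le> ?s2")
    case True
    then have qg: "qg_const smul e es = ?s1" unfolding qg_const_def by (rule min_absorb1)
    obtain q where q: "0 \<le> q" "?s1 = ennreal q" using fin by (cases ?s1) auto
    have "\<forall>k\<in>{1..}. \<forall>G\<in>greedy_ops smul e es k. map_norm G \<le> ennreal q"
      unfolding q(2)[symmetric] all_greedy_ops_def by (blast intro: SUP_upper)
    then have le: "norm (proj L x) \<le> q * norm x" if "greedy x L" "L \<noteq> {}" for L x
      using map_norm_greedy_ops_le_iff(1)[OF q(1)] that card1 by blast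
    \<comment> \<open>The greedy projection onto \<open>{0}\<close> fixes \<open>e 0\<close>, which
      forces \<open>1 \<le> q\<close>.\<close>
    have "greedy (e 0) {0}" unfolding greedy_def by (simp add: es_e)
    moreover have "proj {0} (e 0) = e 0" by (simp add: coord_proj_def es_e)
    ultimately have "1 \<le> q" using le[of "e 0" "{0}"] e_nonzero[of 0] by simp
    moreover have "norm (proj L x) \<le> q * norm x" if "greedy x L" for L x
      using le[OF that] q(1) by (cases "L = {}") auto
    ultimately show thesis using that q qg by metis
  next
    case False
    then have qg: "qg_const smul e es = ?s2" unfolding qg_const_def by (intro min_absorb2) simp
    have "?s2 < \<infinity>" using False fin by (meson not_le order.strict_trans)
    then obtain q where q: "0 \<le> q" "?s2 = ennreal q" by (cases ?s2) auto
    have "\<forall>k\<in>{1..}. \<forall>G\<in>greedy_ops smul e es k. map_norm (\<lambda>x. x - G x) \<le> ennreal q"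
      unfolding q(2)[symmetric] all_greedy_ops_def
      by (intro ballI SUP_upper[of _ _ "\<lambda>G. map_norm (\<lambda>x. x - G x)"] UN_I)
    then have le: "norm (x - proj L x) \<le> q * norm x" if "greedy x L" "L \<noteq> {}" for L x
      using map_norm_greedy_ops_le_iff(2)[OF q(1)] that card1 by blast
    then have "1 \<le> q" by (rule one_le_greedy_complement_bound)
    \<comment> \<open>Greedy operators start at \<open>N = 1\<close>, so the suprema say nothing
      about \<open>L = {}\<close>; there the estimate is exactly what \<open>1 \<le> q\<close>
      gives.\<close>
    moreover have "norm (x - proj L x) \<le> q * norm x" if "greedy x L" for L x
      using le[OF that] \<open>1 \<le> q\<close> by (cases "L = {}") (auto simp: mult_le_cancel_right1)
    ultimately show thesis using that q qg by metis
  qed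
qed

end

section \<open>Upper bounds for the Lebesgue constants\<close>

text \<open>\<open>coefficient_bound\<close> isolates the dependence on the scalar field in the
  single number \<open>c\<close>.\<close>

locale quasi_greedy_system = biorthogonal_system smul e es
  for smul :: "'k::real_normed_field \<Rightarrow> 'a::banach \<Rightarrow> 'a" and e es +
  fixes q c :: real
  assumes one_le_q: "1 \<le> q" and one_le_c: "1 \<le> c"
    and greedy_bound: "(\<forall>x L. greedy x L \<longrightarrow> norm (proj L x) \<le> q * norm x) \<or>
      (\<forall>x L. greedy x L \<longrightarrow> norm (x - proj L x) \<le> q * norm x)"
    and coefficient_bound: "\<And>A a (f :: nat \<Rightarrow> 'a) S. finite A \<Longrightarrow> \<forall>n\<in>A. norm (a n) \<le> 1 \<Longrightarrow>
      \<forall>A'\<subseteq>A. norm (sum f A') \<le> S \<Longrightarrow> norm (\<Sum>n\<in>A. smul (a n) (f n)) \<le> c * S"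
begin

text \<open>The vector is a difference of two greedy sums and also of two greedy remainders, so
  either alternative of \<open>greedy_bound\<close> gives \<open>q\<close> twice.\<close>

lemma norm_proj_greedy_diff:
  assumes "greedy x L1" "greedy x L2" "L1 \<subseteq> L2"
  shows "norm (proj (L2 - L1) x) \<le> 2 * q * norm x"
proof -
  have "finite L2" using assms unfolding greedy_def by blast
  then have "proj L2 x = proj (L2 - L1) x + proj L1 x"
    unfolding coord_proj_def by (rule sum.subset_diff[OF assms(3)])
  then have eq: "proj (L2 - L1) x = proj L2 x - proj L1 x"
    "proj (L2 - L1) x = (x - proj L1 x) - (x - proj L2 x)" by simp_all
  from greedy_bound show ?thesis
  proof
    assume "\<forall>x L. greedy x L \<longrightarrow> norm (proj L x) \<le> q * norm x"
    then have "norm (proj L1 x) \<le> q * norm x" "norm (proj L2 x) \<le> q * norm x" using assms by auto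
    then show ?thesis unfolding eq(1) using norm_triangle_ineq4[of "proj L2 x" "proj L1 x"] by linarith
  next
    assume "\<forall>x L. greedy x L \<longrightarrow> norm (x - proj L x) \<le> q * norm x"
    then have "norm (x - proj L1 x) \<le> q * norm x" "norm (x - proj L2 x) \<le> q * norm x"
      using assms by auto
    then show ?thesis unfolding eq(2)
      using norm_triangle_ineq4[of "x - proj L1 x" "x - proj L2 x"] by linarith
  qed
qed

text \<open>Coefficients of equal modulus make every subset of \<open>L\<close> greedy. With the
  bound on remainders, \<open>L - B\<close> is the set to remove.\<close>

lemma norm_unimodular_subsum_le:
  assumes "finite L" "\<And>n. n \<in> L \<Longrightarrow> norm (u n) = 1" "B \<subseteq> L"
  shows "norm (\<Sum>n\<in>B. smul (u n) (e n)) \<le> q * norm (\<Sum>n\<in>L. smul (u n) (e n))"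
proof -
  let ?x = "\<Sum>n\<in>L. smul (u n) (e n)"
  have greedy: "greedy ?x A" if "A \<subseteq> L" for A
    unfolding greedy_def using assms(1,2) that by (auto simp: es_sum finite_subset)
  have proj: "proj A ?x = (\<Sum>n\<in>A. smul (u n) (e n))" if "A \<subseteq> L" for A
    using proj_sum[of A L u] assms(1) that by (simp add: finite_subset Int_absorb2)
  from greedy_bound show ?thesis
  proof
    assume "\<forall>x L. greedy x L \<longrightarrow> norm (proj L x) \<le> q * norm x"
    then show ?thesis using greedy[OF assms(3)] proj[OF assms(3)] by metis
  next
    assume *: "\<forall>x L. greedy x L \<longrightarrow> norm (x - proj L x) \<le> q * norm x"
    have "?x = (\<Sum>n\<in>L - B. smul (u n) (e n)) + (\<Sum>n\<in>B. smul (u n) (e n))"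
      by (rule sum.subset_diff[OF assms(3,1)])
    then have "?x - proj (L - B) ?x = (\<Sum>n\<in>B. smul (u n) (e n))"
      unfolding proj[OF Diff_subset] by (metis add_diff_cancel_left')
    then show ?thesis using greedy[of "L - B"] * by (metis Diff_subset)
  qed
qed

text \<open>The weight \<open>r / norm (es n w)\<close> is at most 1 on \<open>L\<close> and turns
  the coefficient \<open>es n w\<close> into \<open>r\<close> times its sign, so the level-set lemma
  applies.\<close>

lemma norm_sgn_sum_le:
  assumes "0 < r" and L_def: "L = {n. r \<le> norm (es n w)}"
  shows "r * norm (\<Sum>n\<in>L. smul (sgn (es n w)) (e n)) \<le> 2 * q * norm w"
proof -
  have fin: "finite L" unfolding L_def by (rule finite_large_coefficients[OF assms(1)])
  have sgn: "smul (sgn a) v = (1 / norm a) *\<^sub>R smul a v" for a :: 'k and v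
    unfolding sgn_div_norm scaleR_conv_of_real scale_scale[symmetric] smul_of_real
    by (simp add: inverse_eq_divide)
  have "r * norm (\<Sum>n\<in>L. smul (sgn (es n w)) (e n))
      = norm (r *\<^sub>R (\<Sum>n\<in>L. smul (sgn (es n w)) (e n)))"
    using assms(1) by simp
  also have "r *\<^sub>R (\<Sum>n\<in>L. smul (sgn (es n w)) (e n))
      = (\<Sum>n\<in>L. (r / norm (es n w)) *\<^sub>R smul (es n w) (e n))"
    by (simp add: scaleR_sum_right sgn)
  also have "norm \<dots> \<le> 1 * (2 * q * norm w)"
  proof (rule norm_sum_scaleR_le_level_sums[OF fin])
    fix s :: real assume s: "0 < s"
    \<comment> \<open>The weight decreases as the modulus grows, so each of its level sets is
      \<open>L\<close> minus a greedy set.\<close>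
    define L1 where "L1 = {n\<in>L. r < s * norm (es n w)}"
    have pos: "0 < norm (es n w)" if "n \<in> L" for n
      using that assms(1) unfolding L_def mem_Collect_eq by linarith
    have "s \<le> r / norm (es n w) \<longleftrightarrow> \<not> r < s * norm (es n w)" if "n \<in> L" for n
      using pos[OF that] by (simp add: pos_le_divide_eq not_less)
    then have U: "{n \<in> L. s \<le> r / norm (es n w)} = L - L1" unfolding L1_def by auto
    have "greedy w L" unfolding greedy_def using fin unfolding L_def by force
    moreover have "greedy w L1" unfolding greedy_def
    proof (intro conjI ballI)
      show "finite L1" unfolding L1_def using fin by simp
      fix n m assume n: "n \<in> L1" and m: "m \<in> - L1"
      show "norm (es m w) \<le> norm (es n w)"
      proof (cases "m \<in> L")
        case True
        then have "s * norm (es m w) \<le> s * norm (es n w)" using n m unfolding L1_def by auto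
        then show ?thesis using s by simp
      next
        case False
        then show ?thesis using n unfolding L1_def L_def by auto
      qed
    qed
    ultimately have "norm (proj (L - L1) w) \<le> 2 * q * norm w"
      by (intro norm_proj_greedy_diff) (auto simp: L1_def)
    then show "norm (\<Sum>n\<in>{n \<in> L. s \<le> r / norm (es n w)}. smul (es n w) (e n)) \<le> 2 * q * norm w"
      unfolding U coord_proj_def .
  qed (use assms one_le_q in \<open>auto simp: divide_le_eq\<close>)
  finally show ?thesis by simp
qed

text \<open>Serves both upper bounds: agreement of \<open>w\<close> and \<open>x\<close> on
  \<open>L - A\<close> holds for any competitor supported in \<open>A\<close>. One \<open>c\<close>
  comes from the coefficients on \<open>A - L\<close>, one from inserting signs; one
  \<open>q\<close> comes from enlarging \<open>B\<close>, and \<open>2 * q\<close> from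
  \<open>norm_sgn_sum_le\<close>.\<close>

lemma norm_proj_uncaptured_le:
  assumes L: "greedy x L" and A: "finite A" "card A \<le> card L"
    and w: "\<And>n. n \<in> L - A \<Longrightarrow> es n w = es n x"
    and m: "0 \<le> m" "mu_const e (card L) \<le> ennreal m"
  shows "norm (proj (A - L) x) \<le> 2 * c\<^sup>2 * q\<^sup>2 * m * norm w"
proof -
  have fin: "finite L" using L unfolding greedy_def by blast
  have rhs: "0 \<le> 2 * c\<^sup>2 * q\<^sup>2 * m * norm w" using m(1) by simp
  show ?thesis
  proof (cases "A \<subseteq> L")
    case True
    then have "A - L = {}" by blast
    then have "proj (A - L) x = 0" by (simp only: proj_empty)
    then show ?thesis using rhs by simp
  next
    case False
    then have "L \<noteq> {}" using A by auto
    then have "Min ((\<lambda>n. norm (es n x)) ` L) \<in> (\<lambda>n. norm (es n x)) ` L" using fin by simp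
    then obtain k where k: "k \<in> L" "norm (es k x) = Min ((\<lambda>n. norm (es n x)) ` L)" by auto
    define r where "r = norm (es k x)"
    have rL: "r \<le> norm (es n x)" if "n \<in> L" for n unfolding r_def k(2) using fin that by simp
    have rA: "norm (es n x) \<le> r" if "n \<in> A - L" for n
      unfolding r_def using L k(1) that unfolding greedy_def by blast
    show ?thesis
    \<comment> \<open>The set \<open>D\<close> below is finite because \<open>0 < r\<close>; for
      \<open>r = 0\<close> all coefficients on \<open>A - L\<close> vanish.\<close>
    proof (cases "r = 0")
      case True
      then have "proj (A - L) x = proj (A - L) 0" by (intro proj_cong) (use rA in auto)
      then show ?thesis using rhs by simp
    next
      case False
      then have r: "0 < r" unfolding r_def by simp
      define D where "D = {n. r \<le> norm (es n w)}"
      define u where "u n = sgn (es n w)" for n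
      define V where "V = norm (\<Sum>n\<in>D. smul (u n) (e n))"
      have finD: "finite D" unfolding D_def by (rule finite_large_coefficients[OF r])
      have LD: "L - A \<subseteq> D" unfolding D_def using w rL by auto
      have u: "norm (u n) = 1" if "n \<in> D" for n
        using that r unfolding u_def D_def by (auto simp: norm_sgn)
      have V: "r * V \<le> 2 * q * norm w"
        unfolding V_def D_def u_def by (rule norm_sgn_sum_le[OF r refl])
      have indicator_le: "norm (\<Sum>n\<in>A'. e n) \<le> m * (c * (q * V))" if A': "A' \<subseteq> A - L" for A'
      proof -
        have "card A' \<le> card (A - L)" using A' A(1) by (simp add: card_mono)
        \<comment> \<open>Discarding the common part \<open>A \<inter> L\<close> preserves
          \<open>card A \<le> card L\<close>.\<close>
        also have "\<dots> \<le> card (L - A)"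
          using A fin card_Diff_subset_Int[of A L] card_Diff_subset_Int[of L A]
          by (simp add: Int_commute)
        finally obtain B where B: "B \<subseteq> L - A" "card B = card A'" "finite B"
          using obtain_subset_with_card_n by metis
        have "card B \<le> card L" using B(1) fin by (intro card_mono) auto
        moreover have "finite A'" using A' A(1) by (meson finite_Diff finite_subset)
        ultimately have "norm (\<Sum>n\<in>A'. e n) \<le> m * norm (\<Sum>n\<in>B. e n)"
          using m(2) B unfolding mu_const_le_iff[OF m(1)] by simp
        \<comment> \<open>Signs are inserted here: the inverse signs have modulus 1 and serve as the
          coefficients in \<open>coefficient_bound\<close>.\<close>
        also have "(\<Sum>n\<in>B. e n) = (\<Sum>n\<in>B. smul (inverse (u n)) (smul (u n) (e n)))"
        proof (rule sum.cong[OF refl])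
          fix n assume "n \<in> B"
          then have "u n \<noteq> 0" using u[of n] B(1) LD by force
          then show "e n = smul (inverse (u n)) (smul (u n) (e n))" by simp
        qed
        also have "norm \<dots> \<le> c * (q * V)"
        proof (rule coefficient_bound[OF B(3)])
          show "\<forall>n\<in>B. norm (inverse (u n)) \<le> 1" using u B(1) LD by (auto simp: norm_inverse)
          show "\<forall>B'\<subseteq>B. norm (\<Sum>n\<in>B'. smul (u n) (e n)) \<le> q * V"
            unfolding V_def using norm_unimodular_subsum_le[where u = u, OF finD u] B(1) LD by blast
        qed
        finally show ?thesis using m(1) by (simp add: mult_left_mono)
      qed
      \<comment> \<open>After division by \<open>r\<close> the coefficients on \<open>A - L\<close>
        have modulus at most 1.\<close>
      have "proj (A - L) x = r *\<^sub>R (\<Sum>n\<in>A - L. smul (es n x / of_real r) (e n))"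
        unfolding scaleR_sum_right coord_proj_def using r
        by (intro sum.cong) (simp_all flip: smul_of_real)
      then have "norm (proj (A - L) x) = r * norm (\<Sum>n\<in>A - L. smul (es n x / of_real r) (e n))"
        using r by simp
      also have "\<dots> \<le> r * (c * (m * (c * (q * V))))"
        using r rA A(1) indicator_le
        by (intro mult_left_mono coefficient_bound) (auto simp: norm_divide)
      also have "\<dots> = c\<^sup>2 * q * m * (r * V)" by (simp add: power2_eq_square mult_ac)
      also have "\<dots> \<le> c\<^sup>2 * q * m * (2 * q * norm w)"
        using V m(1) one_le_q by (intro mult_left_mono) auto
      also have "\<dots> = 2 * c\<^sup>2 * q\<^sup>2 * m * norm w" by (simp add: power2_eq_square mult_ac)
      finally show ?thesis .
    qed
  qed
qed

lemma mu_const_real: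
  obtains m where "0 \<le> m" "mu_const e N = ennreal m" "1 \<le> N \<Longrightarrow> 1 \<le> m"
proof -
  obtain m where "0 \<le> m" "mu_const e N = ennreal m"
    using mu_const_finite[of N] by (cases "mu_const e N") auto
  then show thesis using that mu_const_ge_one[of N] by (simp flip: ennreal_1)
qed

lemma ennreal_bound_eq:
  assumes "0 \<le> k" "0 \<le> m"
  shows "ennreal k + ennreal (2 * c\<^sup>2) * (ennreal q)\<^sup>2 * ennreal m = ennreal (k + 2 * c\<^sup>2 * q\<^sup>2 * m)"
  using assms one_le_q by (simp add: ennreal_mult ennreal_power)

text \<open>The complement of \<open>proj (A \<union> L)\<close> annihilates the competitor
  \<open>z\<close>, and \<open>A \<union> L\<close> has up to \<open>2 * N\<close> elements; this is
  the source of the index of \<open>kc_const\<close>.\<close>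

lemma lebesgue_const_upper:
  "lebesgue_const smul e es N
    \<le> kc_const smul e es (2 * N) + ennreal (2 * c\<^sup>2) * (ennreal q)\<^sup>2 * mu_const e N"
proof (cases "kc_const smul e es (2 * N)")
  case (real k)
  obtain m where m: "0 \<le> m" "mu_const e N = ennreal m" by (rule mu_const_real)
  have k: "norm (x - proj A x) \<le> k * norm x" if "finite A" "card A \<le> 2 * N" for A x
    using kc_const_le_iff[OF real(1), of "2 * N"] real that by simp
  show ?thesis unfolding real m ennreal_bound_eq[OF real(1) m(1)]
  proof (rule lebesgue_const_leI)
    fix x L and A :: "nat set" and a
    assume *: "greedy x L" "card L = N" "finite A" "card A \<le> N"
    have fin: "finite L" using * unfolding greedy_def by blast
    define z where "z = (\<Sum>n\<in>A. smul (a n) (e n))"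
    define w where "w = x - z"
    have "proj (A \<union> L) z = z"
      unfolding z_def using proj_sum[of "A \<union> L" A a] *(3) fin by (simp add: Int_absorb1)
    moreover have "proj (A \<union> L) x = proj (A - L) x + proj L x"
      using proj_Un[of "A - L" L x] *(3) fin by (simp add: Un_Diff_cancel2 Int_commute)
    ultimately have eq: "x - proj L x = (w - proj (A \<union> L) w) + proj (A - L) x"
      unfolding w_def proj_diff by simp
    have 1: "norm (w - proj (A \<union> L) w) \<le> k * norm w"
      using * fin card_Un_le[of A L] by (intro k) auto
    have 2: "norm (proj (A - L) x) \<le> 2 * c\<^sup>2 * q\<^sup>2 * m * norm w"
      by (rule norm_proj_uncaptured_le[OF *(1,3) _ _ m(1)])
        (use * m in \<open>auto simp: w_def z_def es_sum\<close>)
    show "norm (x - proj L x)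
        \<le> (k + 2 * c\<^sup>2 * q\<^sup>2 * m) * norm (x - (\<Sum>n\<in>A. smul (a n) (e n)))"
      unfolding eq distrib_right z_def[symmetric] w_def[symmetric] by (rule norm_triangle_mono[OF 1 2])
  qed (use real m in simp)
qed simp

text \<open>Since \<open>w\<close> vanishes on \<open>A\<close>, the set \<open>L - A\<close> is
  greedy for \<open>w\<close>, so \<open>gc_const\<close> at \<open>N\<close> replaces
  \<open>kc_const\<close> at \<open>2 * N\<close>.\<close>

lemma lebesgue_tilde_const_upper:
  assumes "1 \<le> N"
  shows "lebesgue_tilde_const smul e es N
    \<le> gc_const smul e es N + ennreal (2 * c\<^sup>2) * (ennreal q)\<^sup>2 * mu_const e N"
proof (cases "gc_const smul e es N")
  case (real g)
  obtain m where m: "0 \<le> m" "mu_const e N = ennreal m" "1 \<le> m" using mu_const_real assms by metis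
  have g: "norm (x - proj L x) \<le> g * norm x" if "greedy x L" "card L \<in> {1..N}" for L x
    using gc_const_le_iff[OF real(1), of N] real that by simp
  show ?thesis unfolding real m ennreal_bound_eq[OF real(1) m(1)]
  proof (rule lebesgue_tilde_const_leI)
    fix x L A assume *: "greedy x L" "card L = N" "finite (A :: nat set)" "card A \<le> N"
    have fin: "finite L" using * unfolding greedy_def by blast
    define w where "w = x - proj A x"
    have es_w: "es n w = (if n \<in> A then 0 else es n x)" for n unfolding w_def using *(3) by simp
    show "norm (x - proj L x) \<le> (g + 2 * c\<^sup>2 * q\<^sup>2 * m) * norm (x - proj A x)"
    proof (cases "L \<subseteq> A")
      \<comment> \<open>\<open>gc_const\<close> covers nonempty greedy sets only, and
        \<open>L - A\<close> is empty here. The cardinalities force \<open>L = A\<close>, so it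
        suffices that the constant is at least 1, which uses \<open>1 \<le> m\<close>.\<close>
      case True
      then have "L = A" using * by (intro card_seteq) auto
      moreover have "1 \<le> c\<^sup>2 * q\<^sup>2 * m"
        using one_le_c one_le_q m(3) by (metis mult_ge1_I one_le_power mult.assoc)
      then have "1 \<le> g + 2 * c\<^sup>2 * q\<^sup>2 * m" using real(1) by simp
      ultimately show ?thesis by (simp add: mult_le_cancel_right1)
    next
      case False
      have "greedy w (L - A)" using *(1) unfolding greedy_def es_w by auto
      moreover have "card (L - A) \<in> {1..N}"
        using False fin *(2) card_mono[of L "L - A"] by (auto simp: Suc_le_eq card_gt_0_iff)
      ultimately have 1: "norm (w - proj (L - A) w) \<le> g * norm w" by (rule g)
      have 2: "norm (proj (A - L) x) \<le> 2 * c\<^sup>2 * q\<^sup>2 * m * norm w"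
        by (rule norm_proj_uncaptured_le[OF *(1,3) _ _ m(1)]) (use * m in \<open>auto simp: es_w\<close>)
      have "proj (L - A) w = proj (L - A) x" by (rule proj_cong) (simp add: es_w)
      moreover have "proj A x + proj (L - A) x = proj (A - L) x + proj L x"
        using proj_Un[of A "L - A" x] proj_Un[of "A - L" L x] *(3) fin
        by (simp add: Un_Diff_cancel Un_Diff_cancel2 Int_commute)
      ultimately have eq: "x - proj L x = (w - proj (L - A) w) + proj (A - L) x"
        unfolding w_def by (simp add: algebra_simps)
      show ?thesis
        unfolding eq distrib_right w_def[symmetric] by (rule norm_triangle_mono[OF 1 2])
    qed
  qed (use real m in simp)
qed simp

end

section \<open>Assembly for real and complex scalars\<close>

text \<open>Common form for both scalar fields: \<open>c = 2\<close> turns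
  \<open>2 * c\<^sup>2\<close> into 8, and \<open>c = 4\<close> turns it into 32.\<close>

lemma lebesgue_inequalities:
  fixes smul :: "'k::real_normed_field \<Rightarrow> 'a::banach \<Rightarrow> 'a"
  assumes system: "seminormalized_biorthogonal_system smul e es" and qg: "quasi_greedy smul e es"
    and "1 \<le> c" "1 \<le> N"
    and coefficient_bound: "\<And>A a (f :: nat \<Rightarrow> 'a) S. finite A \<Longrightarrow> \<forall>n\<in>A. norm (a n) \<le> 1 \<Longrightarrow>
      \<forall>A'\<subseteq>A. norm (sum f A') \<le> S \<Longrightarrow> norm (\<Sum>n\<in>A. smul (a n) (f n)) \<le> c * S"
  shows "max (kc_const smul e es N) (mu_const e N) \<le> lebesgue_const smul e es N"
    and "lebesgue_const smul e es N \<le> kc_const smul e es (2 * N)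
      + ennreal (2 * c\<^sup>2) * (qg_const smul e es)\<^sup>2 * mu_const e N"
    and "max (gc_const smul e es N) (mu_const e N) \<le> lebesgue_tilde_const smul e es N"
    and "lebesgue_tilde_const smul e es N \<le> gc_const smul e es N
      + ennreal (2 * c\<^sup>2) * (qg_const smul e es)\<^sup>2 * mu_const e N"
proof -
  interpret biorthogonal_system smul e es by unfold_locales (rule system)
  obtain q where q: "1 \<le> q" "qg_const smul e es = ennreal q"
    "(\<forall>x L. greedy x L \<longrightarrow> norm (proj L x) \<le> q * norm x) \<or>
     (\<forall>x L. greedy x L \<longrightarrow> norm (x - proj L x) \<le> q * norm x)"
    using qg_const_real[OF qg] .
  interpret quasi_greedy_system smul e es q c
    by unfold_locales (fact q assms)+
  show "max (kc_const smul e es N) (mu_const e N) \<le> lebesgue_const smul e es N"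
    using kc_const_le_lebesgue_const mu_const_le_lebesgue_tilde_const
      lebesgue_tilde_const_le_lebesgue_const by (meson max.boundedI order_trans)
  show "max (gc_const smul e es N) (mu_const e N) \<le> lebesgue_tilde_const smul e es N"
    using gc_const_le_lebesgue_tilde_const mu_const_le_lebesgue_tilde_const by simp
  show "lebesgue_const smul e es N \<le> kc_const smul e es (2 * N)
      + ennreal (2 * c\<^sup>2) * (qg_const smul e es)\<^sup>2 * mu_const e N"
    unfolding q(2) by (rule lebesgue_const_upper)
  show "lebesgue_tilde_const smul e es N \<le> gc_const smul e es N
      + ennreal (2 * c\<^sup>2) * (qg_const smul e es)\<^sup>2 * mu_const e N"
    unfolding q(2) by (rule lebesgue_tilde_const_upper[OF assms(4)])
qed

lemma real_coefficient_bound: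
  fixes smul :: "real \<Rightarrow> 'a::banach \<Rightarrow> 'a"
  assumes "banach_over smul" "finite A" "\<forall>n\<in>A. norm (a n) \<le> 1" "\<forall>A'\<subseteq>A. norm (sum f A') \<le> S"
  shows "norm (\<Sum>n\<in>A. smul (a n) (f n)) \<le> 2 * S"
proof -
  have "smul r x = r *\<^sub>R x" for r x
    using assms(1) unfolding banach_over_def by (metis of_real_eq_id id_apply)
  then show ?thesis using norm_sum_scaleR_le_subset_sums[OF assms(2) _ assms(4), of a] assms(3) by simp
qed

text \<open>The real and imaginary parts of the coefficients contribute \<open>2 * S\<close> each,
  as multiplication by the imaginary unit preserves the norm.\<close>

lemma complex_coefficient_bound:
  fixes smul :: "complex \<Rightarrow> 'a::banach \<Rightarrow> 'a"
  assumes "banach_over smul" "finite A" "\<forall>n\<in>A. norm (a n) \<le> 1" "\<forall>A'\<subseteq>A. norm (sum f A') \<le> S"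
  shows "norm (\<Sum>n\<in>A. smul (a n) (f n)) \<le> 4 * S"
proof -
  interpret vector_space smul using assms(1) unfolding banach_over_def by blast
  have of_real: "smul (of_real r) x = r *\<^sub>R x" and norm: "norm (smul z x) = norm z * norm x" for r z x
    using assms(1) unfolding banach_over_def by auto
  let ?R = "\<Sum>n\<in>A. Re (a n) *\<^sub>R f n" and ?I = "\<Sum>n\<in>A. Im (a n) *\<^sub>R f n"
  have "smul (a n) (f n) = Re (a n) *\<^sub>R f n + smul \<i> (Im (a n) *\<^sub>R f n)" for n
    using complex_eq[of "a n"] by (metis of_real scale_left_distrib scale_scale)
  then have "(\<Sum>n\<in>A. smul (a n) (f n)) = ?R + smul \<i> ?I"
    by (simp add: sum.distrib scale_sum_right)
  then have "norm (\<Sum>n\<in>A. smul (a n) (f n)) \<le> norm ?R + norm ?I"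
    using norm_triangle_ineq[of ?R "smul \<i> ?I"] by (simp add: norm)
  moreover have "norm ?R \<le> 2 * S" "norm ?I \<le> 2 * S"
    by (rule norm_sum_scaleR_le_subset_sums[OF assms(2) _ assms(4)];
        use assms(3) abs_Re_le_cmod abs_Im_le_cmod order_trans in blast)+
  ultimately show ?thesis by linarith
qed

theorem corollary1p7:
  shows
    "(\<forall>(smul :: real \<Rightarrow> 'a::banach \<Rightarrow> 'a) (e :: nat \<Rightarrow> 'a) (es :: nat \<Rightarrow> 'a \<Rightarrow> real).
        seminormalized_biorthogonal_system smul e es \<and> quasi_greedy smul e es \<longrightarrow>
        (\<forall>N\<ge>1.
          max (kc_const smul e es N) (mu_const e N) \<le> lebesgue_const smul e es N \<and>
          lebesgue_const smul e es N
            \<le> kc_const smul e es (2 * N) + 8 * (qg_const smul e es)\<^sup>2 * mu_const e N \<and>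
          max (gc_const smul e es N) (mu_const e N) \<le> lebesgue_tilde_const smul e es N \<and>
          lebesgue_tilde_const smul e es N
            \<le> gc_const smul e es N + 8 * (qg_const smul e es)\<^sup>2 * mu_const e N))
     \<and>
     (\<forall>(smul :: complex \<Rightarrow> 'b::banach \<Rightarrow> 'b) (e :: nat \<Rightarrow> 'b) (es :: nat \<Rightarrow> 'b \<Rightarrow> complex).
        seminormalized_biorthogonal_system smul e es \<and> quasi_greedy smul e es \<longrightarrow>
        (\<forall>N\<ge>1.
          max (kc_const smul e es N) (mu_const e N) \<le> lebesgue_const smul e es N \<and>
          lebesgue_const smul e es N
            \<le> kc_const smul e es (2 * N) + 32 * (qg_const smul e es)\<^sup>2 * mu_const e N \<and>
          max (gc_const smul e es N) (mu_const e N) \<le> lebesgue_tilde_const smul e es N \<and>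
          lebesgue_tilde_const smul e es N
            \<le> gc_const smul e es N + 32 * (qg_const smul e es)\<^sup>2 * mu_const e N))"
proof (intro conjI allI impI; elim conjE)
  fix smul :: "real \<Rightarrow> 'a \<Rightarrow> 'a" and e es N
  assume *: "seminormalized_biorthogonal_system smul e es" "quasi_greedy smul e es" "1 \<le> (N::nat)"
  then have "banach_over smul" unfolding seminormalized_biorthogonal_system_def by blast
  note coefficient_bound = real_coefficient_bound[OF this]
  have one_le: "1 \<le> (2::real)" and const: "ennreal (2 * 2\<^sup>2) = 8" by simp_all
  note bounds = lebesgue_inequalities[OF *(1,2) one_le *(3) coefficient_bound, unfolded const]
  show "max (kc_const smul e es N) (mu_const e N) \<le> lebesgue_const smul e es N"
    "lebesgue_const smul e es N
      \<le> kc_const smul e es (2 * N) + 8 * (qg_const smul e es)\<^sup>2 * mu_const e N"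
    "max (gc_const smul e es N) (mu_const e N) \<le> lebesgue_tilde_const smul e es N"
    "lebesgue_tilde_const smul e es N
      \<le> gc_const smul e es N + 8 * (qg_const smul e es)\<^sup>2 * mu_const e N"
    by (simp_all only: bounds)
next
  fix smul :: "complex \<Rightarrow> 'b \<Rightarrow> 'b" and e es N
  assume *: "seminormalized_biorthogonal_system smul e es" "quasi_greedy smul e es" "1 \<le> (N::nat)"
  then have "banach_over smul" unfolding seminormalized_biorthogonal_system_def by blast
  note coefficient_bound = complex_coefficient_bound[OF this]
  have one_le: "1 \<le> (4::real)" and const: "ennreal (2 * 4\<^sup>2) = 32" by simp_all
  note bounds = lebesgue_inequalities[OF *(1,2) one_le *(3) coefficient_bound, unfolded const]
  show "max (kc_const smul e es N) (mu_const e N) \<le> lebesgue_const smul e es N"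
    "lebesgue_const smul e es N
      \<le> kc_const smul e es (2 * N) + 32 * (qg_const smul e es)\<^sup>2 * mu_const e N"
    "max (gc_const smul e es N) (mu_const e N) \<le> lebesgue_tilde_const smul e es N"
    "lebesgue_tilde_const smul e es N
      \<le> gc_const smul e es N + 32 * (qg_const smul e es)\<^sup>2 * mu_const e N"
    by (simp_all only: bounds)
qed

end
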